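(* Let $\Gamma$ be an uncountable set and $1<p<\infty$. There exists an equivalent norm on $\ell_p(\Gamma)$ whose closed unit ball, considered in the weak topology, does not satisfy property (Q) and hence is not polyadic.
   Context: $\ell_p(\Gamma)$ is the real Banach space of functions $x:\Gamma\to\mathbb{R}$ with $\sum_{\gamma\in\Gamma}|x_\gamma|^p<\infty$, with its usual norm; an equivalent norm is a norm inducing the same topology. Since $\ell_p(\Gamma)$ is reflexive, the closed unit ball of any equivalent norm is compact in the weak topology. Property (Q): a compact (Hausdorff) space $K$ satisfies property (Q) if for every uncountable regular cardinal $\lambda$ and every family $\{U_\alpha,V_\alpha\}_{\alpha<\lambda}$ of open subsets of $K$ with $\overline{U_\alpha}\subset V_\alpha$ for all $\alpha<\lambda$, at least one of the following holds: (1) there exists a set $A\subset\lambda$ with $|A|=\lambda$ such that $U_\alpha\cap U_\beta=\emptyset$ for every two different elements $\alpha,\beta\in A$; or (2) there exists a set $A\subset\lambda$ with $|A|=\lambda$ such that $V_\alpha\cap V_\beta\neq\emptyset$ for every two different elements $\alpha,\beta\in A$. For a set $\Delta$, $\sigma_1(\Delta)$ is the compact subset of $\{0,1\}^\Delta$ (product topology) consisting of the functions with at most one nonzero coordinate. A compact (Hausdorff) space is polyadic if it is a continuous image of $\sigma_1(\Delta)^\Lambda$ (product topology) for some sets $\Delta$ and $\Lambda$. It is a known theorem of Bell that every polyadic space satisfies property (Q). *)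

theory Defs
  imports "HOL-Analysis.Analysis"
begin

unbundle cardinal_syntax

section \<open>The space $\ell_p(\Gamma)$ and its equivalent norms\<close>

text \<open>
  A function on \<open>\<Gamma>\<close> is represented by its extension by \<open>0\<close> to the whole type, so that
  the pointwise operations stay inside the carrier.
\<close>

definition lp :: "'g set \<Rightarrow> real \<Rightarrow> ('g \<Rightarrow> real) set" where
  "lp \<Gamma> p = {x. (\<forall>\<gamma>. \<gamma> \<notin> \<Gamma> \<longrightarrow> x \<gamma> = 0) \<and> (\<lambda>\<gamma>. \<bar>x \<gamma>\<bar> powr p) summable_on \<Gamma>}"

definition lp_norm :: "'g set \<Rightarrow> real \<Rightarrow> ('g \<Rightarrow> real) \<Rightarrow> real" where
  "lp_norm \<Gamma> p x = (\<Sum>\<^sub>\<infinity>\<gamma>\<in>\<Gamma>. \<bar>x \<gamma>\<bar> powr p) powr (1 / p)"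

definition is_norm_on :: "('g \<Rightarrow> real) set \<Rightarrow> (('g \<Rightarrow> real) \<Rightarrow> real) \<Rightarrow> bool" where
  "is_norm_on E N \<longleftrightarrow>
     (\<forall>x\<in>E. 0 \<le> N x \<and> (N x = 0 \<longleftrightarrow> x = (\<lambda>\<gamma>. 0))) \<and>
     (\<forall>x\<in>E. \<forall>c. N (\<lambda>\<gamma>. c * x \<gamma>) = \<bar>c\<bar> * N x) \<and>
     (\<forall>x\<in>E. \<forall>y\<in>E. N (\<lambda>\<gamma>. x \<gamma> + y \<gamma>) \<le> N x + N y)"

definition norm_topology :: "('g \<Rightarrow> real) set \<Rightarrow> (('g \<Rightarrow> real) \<Rightarrow> real) \<Rightarrow> ('g \<Rightarrow> real) topology" where
  "norm_topology E N = Metric_space.mtopology E (\<lambda>x y. N (\<lambda>\<gamma>. x \<gamma> - y \<gamma>))"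

definition equivalent_lp_norm :: "'g set \<Rightarrow> real \<Rightarrow> (('g \<Rightarrow> real) \<Rightarrow> real) \<Rightarrow> bool" where
  "equivalent_lp_norm \<Gamma> p N \<longleftrightarrow>
     is_norm_on (lp \<Gamma> p) N \<and>
     norm_topology (lp \<Gamma> p) N = norm_topology (lp \<Gamma> p) (lp_norm \<Gamma> p)"


section \<open>The weak topology\<close>

definition lp_dual :: "'g set \<Rightarrow> real \<Rightarrow> (('g \<Rightarrow> real) \<Rightarrow> real) set" where
  "lp_dual \<Gamma> p = {\<phi>.
     (\<forall>x\<in>lp \<Gamma> p. \<forall>y\<in>lp \<Gamma> p. \<phi> (\<lambda>\<gamma>. x \<gamma> + y \<gamma>) = \<phi> x + \<phi> y) \<and>
     (\<forall>x\<in>lp \<Gamma> p. \<forall>c. \<phi> (\<lambda>\<gamma>. c * x \<gamma>) = c * \<phi> x) \<and>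
     continuous_map (norm_topology (lp \<Gamma> p) (lp_norm \<Gamma> p)) euclideanreal \<phi>}"

definition lp_weak_topology :: "'g set \<Rightarrow> real \<Rightarrow> ('g \<Rightarrow> real) topology" where
  "lp_weak_topology \<Gamma> p =
     topology_generated_by {{x \<in> lp \<Gamma> p. \<phi> x \<in> S} |\<phi> S. \<phi> \<in> lp_dual \<Gamma> p \<and> open S}"

definition weak_unit_ball ::
  "'g set \<Rightarrow> real \<Rightarrow> (('g \<Rightarrow> real) \<Rightarrow> real) \<Rightarrow> ('g \<Rightarrow> real) topology" where
  "weak_unit_ball \<Gamma> p N = subtopology (lp_weak_topology \<Gamma> p) {x \<in> lp \<Gamma> p. N x \<le> 1}"


section \<open>Property (Q)\<close>

definition uncountable_regular_cardinal :: "'i rel \<Rightarrow> bool" where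
  "uncountable_regular_cardinal r \<longleftrightarrow> Card_order r \<and> regularCard r \<and> uncountable (Field r)"

definition property_Q_at :: "'i rel \<Rightarrow> 'a topology \<Rightarrow> bool" where
  "property_Q_at r K \<longleftrightarrow>
     (\<forall>U V. (\<forall>\<alpha>\<in>Field r. openin K (U \<alpha>) \<and> openin K (V \<alpha>) \<and> K closure_of U \<alpha> \<subseteq> V \<alpha>) \<longrightarrow>
        (\<exists>A\<subseteq>Field r. |A| =o r \<and> (\<forall>\<alpha>\<in>A. \<forall>\<beta>\<in>A. \<alpha> \<noteq> \<beta> \<longrightarrow> U \<alpha> \<inter> U \<beta> = {})) \<or>
        (\<exists>A\<subseteq>Field r. |A| =o r \<and> (\<forall>\<alpha>\<in>A. \<forall>\<beta>\<in>A. \<alpha> \<noteq> \<beta> \<longrightarrow> V \<alpha> \<inter> V \<beta> \<noteq> {})))"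

text \<open>
  A definition cannot quantify over all index types. Cardinals represented on the type of
  pairs of subsets of the space suffice: by \<open>property_Q_imp_property_Q_at\<close> below,
  the condition then holds for uncountable regular cardinals on every type.
\<close>

definition property_Q :: "'a topology \<Rightarrow> bool" where
  "property_Q K \<longleftrightarrow>
     (\<forall>r :: ('a set \<times> 'a set) rel. uncountable_regular_cardinal r \<longrightarrow> property_Q_at r K)"

lemma property_Q_imp_property_Q_at:
  fixes K :: "'a topology" and r :: "'i rel"
  assumes Q: "property_Q K" and r: "uncountable_regular_cardinal r"
  shows "property_Q_at r K"
  unfolding property_Q_at_def
proof (intro allI impI)
  fix U V :: "'i \<Rightarrow> 'a set"
  assume UV: "\<forall>\<alpha>\<in>Field r. openin K (U \<alpha>) \<and> openin K (V \<alpha>) \<and> K closure_of U \<alpha> \<subseteq> V \<alpha>"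
  let ?goal = "(\<exists>A\<subseteq>Field r. |A| =o r \<and> (\<forall>\<alpha>\<in>A. \<forall>\<beta>\<in>A. \<alpha> \<noteq> \<beta> \<longrightarrow> U \<alpha> \<inter> U \<beta> = {})) \<or>
        (\<exists>A\<subseteq>Field r. |A| =o r \<and> (\<forall>\<alpha>\<in>A. \<forall>\<beta>\<in>A. \<alpha> \<noteq> \<beta> \<longrightarrow> V \<alpha> \<inter> V \<beta> \<noteq> {}))"
  have co: "Card_order r" and reg: "regularCard r" and unc: "uncountable (Field r)"
    using r by (auto simp: uncountable_regular_cardinal_def)
  have inf: "\<not> finite (Field r)"
    using unc countable_finite by blast
  have Fr: "|Field r| =o r" by (rule card_of_Field_ordIso[OF co])
  define h where "h \<alpha> = (U \<alpha>, V \<alpha>)" for \<alpha>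
  define fib where "fib q = {\<alpha>\<in>Field r. h \<alpha> = q}" for q
  have le: "|X| \<le>o r" if "X \<subseteq> Field r" for X
    using card_of_mono1[OF that] Fr ordLeq_ordIso_trans by blast
  show ?goal
  proof (cases "\<exists>q \<in> h ` Field r. |fib q| =o r")
    case True
    then obtain \<gamma> where g: "\<gamma> \<in> Field r" "|fib (h \<gamma>)| =o r" by blast
    have sub: "fib (h \<gamma>) \<subseteq> Field r" by (auto simp: fib_def)
    have eq: "U \<alpha> = U \<gamma>" "V \<alpha> = V \<gamma>" if "\<alpha> \<in> fib (h \<gamma>)" for \<alpha>
      using that by (auto simp: fib_def h_def)
    have "U \<gamma> \<subseteq> V \<gamma>"
      using UV g(1) closure_of_subset openin_subset by (metis subset_trans)
    then show ?thesis
      using g(2) sub eq by (cases "V \<gamma> = {}") (metis inf.idem subset_empty)+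
  next
    case False
    have lt: "|fib q| <o r" if "q \<in> h ` Field r" for q
    proof -
      have "|fib q| \<le>o r" by (rule le) (auto simp: fib_def)
      then show ?thesis using False that ordLeq_iff_ordLess_or_ordIso by blast
    qed
    define B where "B = h ` Field r"
    have BF: "|B| \<le>o r"
      unfolding B_def using card_of_image Fr ordLeq_ordIso_trans by blast
    have "\<not> |B| <o r"
    proof
      assume "|B| <o r"
      then have "|\<Union>q\<in>B. fib q| <o r"
        using stable_UNION[OF regularCard_stable[OF co inf reg]] lt B_def by blast
      moreover have "(\<Union>q\<in>B. fib q) = Field r" by (auto simp: B_def fib_def)
      ultimately show False using Fr not_ordLess_ordIso by metis
    qed
    with BF have Br: "|B| =o r" using ordLeq_iff_ordLess_or_ordIso by blast
    have "Cinfinite r" using co inf by (simp add: cinfinite_def)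
    then have "regularCard |B|"
      using regularCard_ordIso[OF ordIso_symmetric[OF Br]] reg by blast
    moreover have "uncountable B"
    proof
      assume "countable B"
      obtain e where e: "bij_betw e B (Field r)"
        using Br Fr card_of_ordIso ordIso_symmetric ordIso_transitive by blast
      then have "countable (Field r)"
        using \<open>countable B\<close> by (metis bij_betw_imp_surj_on countable_image)
      with unc show False by blast
    qed
    ultimately have "uncountable_regular_cardinal |B|"
      by (simp add: uncountable_regular_cardinal_def card_of_card_order_on Field_card_of)
    then have at: "property_Q_at |B| K" using Q by (simp add: property_Q_def)
    define g where "g = inv_into (Field r) h"
    have gF: "g q \<in> Field r" and hg: "h (g q) = q" if "q \<in> B" for q
      using that by (auto simp: B_def g_def inv_into_into f_inv_into_f)
    have gUV: "fst q = U (g q)" "snd q = V (g q)" if "q \<in> B" for q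
      using hg[OF that] unfolding h_def by (metis fst_conv, metis snd_conv)
    have ginj: "inj_on g B" using hg by (metis inj_onI)
    have "\<forall>q\<in>Field |B|. openin K (fst q) \<and> openin K (snd q) \<and> K closure_of fst q \<subseteq> snd q"
      using UV gF gUV by (simp add: Field_card_of)
    from at[unfolded property_Q_at_def, rule_format, OF this[rule_format]]
    have "(\<exists>A\<subseteq>B. |A| =o |B| \<and> (\<forall>\<alpha>\<in>A. \<forall>\<beta>\<in>A. \<alpha> \<noteq> \<beta> \<longrightarrow> fst \<alpha> \<inter> fst \<beta> = {})) \<or>
          (\<exists>A\<subseteq>B. |A| =o |B| \<and> (\<forall>\<alpha>\<in>A. \<forall>\<beta>\<in>A. \<alpha> \<noteq> \<beta> \<longrightarrow> snd \<alpha> \<inter> snd \<beta> \<noteq> {}))"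
      by (simp add: Field_card_of)
    moreover have tr: "g ` A \<subseteq> Field r \<and> |g ` A| =o r" if "A \<subseteq> B" "|A| =o |B|" for A
    proof -
      have "bij_betw g A (g ` A)"
        using ginj that(1) by (meson inj_on_imp_bij_betw inj_on_subset)
      then have "|A| =o |g ` A|" using card_of_ordIso by blast
      then have "|g ` A| =o r"
        using that(2) Br ordIso_symmetric ordIso_transitive by meson
      then show ?thesis using gF that(1) by blast
    qed
    ultimately show ?thesis
    proof (elim disjE exE conjE)
      fix A assume A: "A \<subseteq> B" "|A| =o |B|"
        and d: "\<forall>\<alpha>\<in>A. \<forall>\<beta>\<in>A. \<alpha> \<noteq> \<beta> \<longrightarrow> fst \<alpha> \<inter> fst \<beta> = {}"
      have "\<forall>\<alpha>\<in>g ` A. \<forall>\<beta>\<in>g ` A. \<alpha> \<noteq> \<beta> \<longrightarrow> U \<alpha> \<inter> U \<beta> = {}"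
      proof (intro ballI impI)
        fix \<alpha> \<beta> assume "\<alpha> \<in> g ` A" "\<beta> \<in> g ` A" "\<alpha> \<noteq> \<beta>"
        then obtain q q' where "q \<in> A" "q' \<in> A" "q \<noteq> q'" "\<alpha> = g q" "\<beta> = g q'" by blast
        then show "U \<alpha> \<inter> U \<beta> = {}" using d gUV A(1) by (metis subsetD)
      qed
      then show ?thesis using tr[OF A] by blast
    next
      fix A assume A: "A \<subseteq> B" "|A| =o |B|"
        and d: "\<forall>\<alpha>\<in>A. \<forall>\<beta>\<in>A. \<alpha> \<noteq> \<beta> \<longrightarrow> snd \<alpha> \<inter> snd \<beta> \<noteq> {}"
      have "\<forall>\<alpha>\<in>g ` A. \<forall>\<beta>\<in>g ` A. \<alpha> \<noteq> \<beta> \<longrightarrow> V \<alpha> \<inter> V \<beta> \<noteq> {}"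
      proof (intro ballI impI)
        fix \<alpha> \<beta> assume "\<alpha> \<in> g ` A" "\<beta> \<in> g ` A" "\<alpha> \<noteq> \<beta>"
        then obtain q q' where "q \<in> A" "q' \<in> A" "q \<noteq> q'" "\<alpha> = g q" "\<beta> = g q'" by blast
        then show "V \<alpha> \<inter> V \<beta> \<noteq> {}" using d gUV A(1) by (metis subsetD)
      qed
      then show ?thesis using tr[OF A] by blast
    qed
  qed
qed


section \<open>Polyadic spaces\<close>

definition sigma1 :: "'d set \<Rightarrow> ('d \<Rightarrow> nat) topology" where
  "sigma1 \<Delta> = subtopology (product_topology (\<lambda>_. discrete_topology {0, 1}) \<Delta>)
     {x. \<forall>d\<in>\<Delta>. \<forall>d'\<in>\<Delta>. x d \<noteq> 0 \<and> x d' \<noteq> 0 \<longrightarrow> d = d'}"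

text \<open>
  As above, the index sets have to live in a fixed type. The type used here suffices:
  by \<open>polyadicI\<close> below, a $T_1$ space that is a continuous image of \<open>\<sigma>\<^sub>1(\<Delta>)\<^sup>\<Lambda>\<close>, for sets
  \<open>\<Delta>\<close> and \<open>\<Lambda>\<close> of any types, is polyadic in the sense of this definition.
\<close>

definition polyadic :: "'a topology \<Rightarrow> bool" where
  "polyadic K \<longleftrightarrow>
     (\<exists>(\<Delta> :: ('a \<times> 'a \<times> nat) set) (\<Lambda> :: ('a \<times> 'a \<times> nat) set) f.
        continuous_map (product_topology (\<lambda>_. sigma1 \<Delta>) \<Lambda>) K f \<and>
        f ` topspace (product_topology (\<lambda>_. sigma1 \<Delta>) \<Lambda>) = topspace K)"

lemma topspace_sigma1:
  "topspace (sigma1 \<Delta>) =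
     {x \<in> \<Delta> \<rightarrow>\<^sub>E {0, 1}. \<forall>d\<in>\<Delta>. \<forall>d'\<in>\<Delta>. x d \<noteq> 0 \<and> x d' \<noteq> 0 \<longrightarrow> d = d'}"
  by (auto simp: sigma1_def)

lemma continuous_map_sigma1_coord:
  "d \<in> \<Delta> \<Longrightarrow> continuous_map (sigma1 \<Delta>) (discrete_topology {0, 1}) (\<lambda>x. x d)"
  unfolding sigma1_def
  by (intro continuous_map_from_subtopology continuous_map_product_projection)

lemma compact_space_sigma1: "compact_space (sigma1 \<Delta>)"
proof -
  let ?P = "product_topology (\<lambda>_. discrete_topology {0, 1 :: nat}) \<Delta>"
  let ?S = "{x. \<forall>d\<in>\<Delta>. \<forall>d'\<in>\<Delta>. x d \<noteq> 0 \<and> x d' \<noteq> 0 \<longrightarrow> d = d'}"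
  let ?C = "\<lambda>d. {x \<in> topspace ?P. x d = 0}"
  have cl: "closedin ?P (?C d)" if "d \<in> \<Delta>" for d
    using closedin_continuous_map_preimage[OF
        continuous_map_product_projection[OF that, of "\<lambda>_. discrete_topology {0, 1 :: nat}"],
        of "{0}"]
    by simp
  have "closedin ?P (topspace ?P \<inter> ?S)"
  proof -
    have eq: "topspace ?P \<inter> ?S =
        topspace ?P \<inter> \<Inter> (insert (topspace ?P) ((\<lambda>(d, d'). ?C d \<union> ?C d') ` {(d, d'). d \<in> \<Delta> \<and> d' \<in> \<Delta> \<and> d \<noteq> d'}))"
      by (auto simp del: topspace_product_topology)
    show ?thesis
      unfolding eq
      by (intro closedin_Int closedin_topspace closedin_Inter)
        (auto intro!: closedin_Un cl simp del: topspace_product_topology One_nat_def)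
  qed
  moreover have "compact_space ?P"
    by (simp add: compact_space_product_topology compact_space_discrete_topology)
  ultimately have "compactin ?P (topspace ?P \<inter> ?S)"
    by (simp add: closedin_compact_space)
  then have "compact_space (subtopology ?P (topspace ?P \<inter> ?S))"
    using compact_space_subtopology by blast
  then show ?thesis
    unfolding sigma1_def by (simp add: subtopology_restrict del: topspace_product_topology)
qed

lemma sigma1_separating_coordinates:
  assumes K: "t1_space K"
    and f: "continuous_map (product_topology (\<lambda>_. sigma1 \<Delta>) \<Lambda>) K f"
    and pq: "p \<in> topspace K" "q \<in> topspace K" "p \<noteq> q"
  shows "\<exists>F. finite F \<and> F \<subseteq> \<Lambda> \<times> \<Delta> \<and>
    (\<forall>x\<in>topspace (product_topology (\<lambda>_. sigma1 \<Delta>) \<Lambda>).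
     \<forall>y\<in>topspace (product_topology (\<lambda>_. sigma1 \<Delta>) \<Lambda>).
       f x = p \<and> f y = q \<longrightarrow> (\<exists>(l, d)\<in>F. x l d \<noteq> y l d))"
proof -
  define X where "X = product_topology (\<lambda>_. sigma1 \<Delta>) \<Lambda>"
  have cX: "compact_space X"
    unfolding X_def by (simp add: compact_space_product_topology compact_space_sigma1)
  have fX: "continuous_map X K f" using f by (simp add: X_def)
  define pre where "pre a = {x \<in> topspace X. f x \<in> {a}}" for a
  have "compactin X (pre a)" if "a \<in> topspace K" for a
  proof -
    have "closedin K {a}" using K that by (simp add: t1_space_closedin_singleton)
    then show ?thesis
      unfolding pre_def
      by (intro closedin_compact_space[OF cX] closedin_continuous_map_preimage[OF fX])
  qed
  then have comp: "compactin (prod_topology X X) (pre p \<times> pre q)"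
    using pq compactin_Times by blast
  define W where "W = (\<lambda>(l, d). {z \<in> topspace (prod_topology X X). fst z l d \<noteq> snd z l d})"
  have coord: "continuous_map X (discrete_topology {0, 1}) (\<lambda>x. x l d)"
    if "l \<in> \<Lambda>" "d \<in> \<Delta>" for l d
    using continuous_map_compose[OF continuous_map_product_projection[OF that(1)]
        continuous_map_sigma1_coord[OF that(2)]]
    by (simp add: X_def comp_def)
  have opW: "openin (prod_topology X X) (W (l, d))" if "l \<in> \<Lambda>" "d \<in> \<Delta>" for l d
  proof -
    note c1 = continuous_map_compose[OF continuous_map_fst coord[OF that], unfolded comp_def]
    note c2 = continuous_map_compose[OF continuous_map_snd coord[OF that], unfolded comp_def]
    let ?T = "topspace (prod_topology X X)"
    have val: "x l d \<in> {0, 1}" if "x \<in> topspace X" for x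
      using coord[OF \<open>l \<in> \<Lambda>\<close> \<open>d \<in> \<Delta>\<close>] that by (auto simp: continuous_map_def)
    have "W (l, d) =
        ({z \<in> ?T. fst z l d \<in> {0}} \<inter> {z \<in> ?T. snd z l d \<in> {1}}) \<union>
        ({z \<in> ?T. fst z l d \<in> {1}} \<inter> {z \<in> ?T. snd z l d \<in> {0}})"
      (is "_ = ?R")
    proof (intro set_eqI)
      fix z
      show "z \<in> W (l, d) \<longleftrightarrow> z \<in> ?R"
      proof (cases "z \<in> ?T")
        case True
        then have "fst z \<in> topspace X" "snd z \<in> topspace X" by auto
        with val[of "fst z"] val[of "snd z"]
        have "fst z l d = 0 \<or> fst z l d = 1" "snd z l d = 0 \<or> snd z l d = 1" by blast+
        then show ?thesis using True by (elim disjE) (simp_all add: W_def)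
      next
        case False
        then show ?thesis by (simp add: W_def)
      qed
    qed
    also have "openin (prod_topology X X) \<dots>"
      by (intro openin_Un openin_Int openin_continuous_map_preimage[OF c1]
          openin_continuous_map_preimage[OF c2]) auto
    finally show ?thesis .
  qed
  have cov: "pre p \<times> pre q \<subseteq> \<Union> (W ` (\<Lambda> \<times> \<Delta>))"
  proof
    fix z assume z: "z \<in> pre p \<times> pre q"
    obtain x y where [simp]: "z = (x, y)" by (cases z)
    have x: "x \<in> topspace X" "f x = p" and y: "y \<in> topspace X" "f y = q"
      using z by (auto simp: pre_def)
    have "x \<noteq> y" using x y pq by auto
    have "\<exists>l\<in>\<Lambda>. x l \<noteq> y l"
    proof (rule ccontr)
      assume "\<not> ?thesis"
      then have "x = y" using x(1) y(1) by (intro PiE_ext) (auto simp: X_def)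
      with \<open>x \<noteq> y\<close> show False by blast
    qed
    then obtain l where l: "l \<in> \<Lambda>" "x l \<noteq> y l" by blast
    have "x l \<in> topspace (sigma1 \<Delta>)" "y l \<in> topspace (sigma1 \<Delta>)"
      using x(1) y(1) l(1) by (auto simp: X_def)
    then have E: "x l \<in> \<Delta> \<rightarrow>\<^sub>E {0, 1}" "y l \<in> \<Delta> \<rightarrow>\<^sub>E {0, 1}" by (auto simp: topspace_sigma1)
    have "\<exists>d\<in>\<Delta>. x l d \<noteq> y l d"
    proof (rule ccontr)
      assume "\<not> ?thesis"
      then have "x l = y l" using E by (intro PiE_ext) auto
      with l show False by blast
    qed
    then obtain d where "d \<in> \<Delta>" "x l d \<noteq> y l d" by blast
    then show "z \<in> \<Union> (W ` (\<Lambda> \<times> \<Delta>))"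
      using l x y by (intro UN_I[of "(l, d)"]) (auto simp: W_def)
  qed
  have "\<forall>G\<in>W ` (\<Lambda> \<times> \<Delta>). openin (prod_topology X X) G" using opW by auto
  with comp cov have "\<exists>\<F>. finite \<F> \<and> \<F> \<subseteq> W ` (\<Lambda> \<times> \<Delta>) \<and> pre p \<times> pre q \<subseteq> \<Union> \<F>"
    unfolding compactin_def by simp
  then obtain \<F> where F: "finite \<F>" "\<F> \<subseteq> W ` (\<Lambda> \<times> \<Delta>)" "pre p \<times> pre q \<subseteq> \<Union> \<F>"
    by (elim exE conjE)
  obtain F where F': "F \<subseteq> \<Lambda> \<times> \<Delta>" "finite F" "\<F> = W ` F"
    using finite_subset_image[OF F(1,2)] by blast
  have "\<exists>(l, d)\<in>F. x l d \<noteq> y l d"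
    if "x \<in> topspace X" "y \<in> topspace X" "f x = p" "f y = q" for x y
  proof -
    have "(x, y) \<in> pre p \<times> pre q" using that by (auto simp: pre_def)
    then obtain c where "c \<in> F" "(x, y) \<in> W c" using F(3) F'(3) by blast
    then show ?thesis by (cases c) (auto simp: W_def)
  qed
  then show ?thesis using F' unfolding X_def by blast
qed

lemma polyadicI:
  fixes K :: "'a topology" and \<Delta> :: "'d set" and \<Lambda> :: "'l set"
  assumes K: "t1_space K"
    and f: "continuous_map (product_topology (\<lambda>_. sigma1 \<Delta>) \<Lambda>) K f"
    and surj: "f ` topspace (product_topology (\<lambda>_. sigma1 \<Delta>) \<Lambda>) = topspace K"
  shows "polyadic K"
proof -
  define X where "X = product_topology (\<lambda>_. sigma1 \<Delta>) \<Lambda>"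
  define sepr where "sepr p q G \<longleftrightarrow> finite G \<and> G \<subseteq> \<Lambda> \<times> \<Delta> \<and>
      (\<forall>x\<in>topspace X. \<forall>y\<in>topspace X. f x = p \<and> f y = q \<longrightarrow> (\<exists>(l, d)\<in>G. x l d \<noteq> y l d))"
    for p q G
  define F where
    "F p q = (if p \<in> topspace K \<and> q \<in> topspace K \<and> p \<noteq> q then SOME G. sepr p q G else {})" for p q
  have sepr: "sepr p q (F p q)" if "p \<in> topspace K" "q \<in> topspace K" "p \<noteq> q" for p q
  proof -
    have "\<exists>G. sepr p q G"
      using sigma1_separating_coordinates[OF K f that] unfolding X_def sepr_def .
    then show ?thesis using that by (simp add: F_def someI_ex)
  qed
  have F: "finite (F p q)" "F p q \<subseteq> \<Lambda> \<times> \<Delta>" for p q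
    using sepr[of p q] by (cases "p \<in> topspace K \<and> q \<in> topspace K \<and> p \<noteq> q"; force simp: sepr_def F_def)+
  have sep: "\<exists>(l, d)\<in>F p q. x l d \<noteq> y l d"
    if "p \<in> topspace K" "q \<in> topspace K" "p \<noteq> q" "x \<in> topspace X" "y \<in> topspace X"
      "f x = p" "f y = q" for p q x y
    using sepr[OF that(1-3)] that(4-7) unfolding sepr_def by blast
  define S where "S = (\<Union>p q. F p q)"
  define h where "h = (\<lambda>(p, q, n). from_nat_into (F p q) n)"
  have Sh: "S \<subseteq> range h"
  proof
    fix c assume "c \<in> S"
    then obtain p q where "c \<in> F p q" by (auto simp: S_def)
    then have "c = h (p, q, to_nat_on (F p q) c)"
      using F(1) by (simp add: h_def countable_finite)
    then show "c \<in> range h" by blast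
  qed
  define hl where "hl t = fst (h t)" for t
  define hd where "hd t = snd (h t)" for t
  define \<Lambda>0 where "\<Lambda>0 = fst ` S"
  define \<Delta>0 where "\<Delta>0 = snd ` S"
  have sub: "\<Lambda>0 \<subseteq> \<Lambda>" "\<Delta>0 \<subseteq> \<Delta>" using F(2) by (fastforce simp: \<Lambda>0_def \<Delta>0_def S_def)+
  define el where "el = inv_into UNIV hl"
  define ed where "ed = inv_into UNIV hd"
  have "\<Lambda>0 \<subseteq> range hl" "\<Delta>0 \<subseteq> range hd"
    using Sh by (auto simp: \<Lambda>0_def \<Delta>0_def hl_def hd_def)
  then have hel: "\<And>l. l \<in> \<Lambda>0 \<Longrightarrow> hl (el l) = l" and hed: "\<And>d. d \<in> \<Delta>0 \<Longrightarrow> hd (ed d) = d"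
    by (auto simp: el_def ed_def f_inv_into_f subset_iff)
  define \<Lambda>' where "\<Lambda>' = el ` \<Lambda>0"
  define \<Delta>' where "\<Delta>' = ed ` \<Delta>0"
  define X' where "X' = product_topology (\<lambda>_. sigma1 \<Delta>') \<Lambda>'"
  define E where "E z = (\<lambda>l\<in>\<Lambda>. \<lambda>d\<in>\<Delta>. if l \<in> \<Lambda>0 \<and> d \<in> \<Delta>0 then z (el l) (ed d) else (0::nat))" for z
  have zs: "z (el l) \<in> topspace (sigma1 \<Delta>')" if "z \<in> topspace X'" "l \<in> \<Lambda>0" for z l
    using that by (auto simp: X'_def \<Lambda>'_def)
  have EX: "E z l \<in> topspace (sigma1 \<Delta>)" if z: "z \<in> topspace X'" and l: "l \<in> \<Lambda>" for z l
  proof (cases "l \<in> \<Lambda>0")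
    case True
    note s = zs[OF z True, unfolded topspace_sigma1]
    have v: "z (el l) (ed d) \<in> {0, 1}" if "d \<in> \<Delta>0" for d
      using s that by (auto simp: \<Delta>'_def)
    have u: "d = d'" if "d \<in> \<Delta>0" "d' \<in> \<Delta>0" "z (el l) (ed d) \<noteq> 0" "z (el l) (ed d') \<noteq> 0" for d d'
    proof -
      have "ed d = ed d'" using s that unfolding \<Delta>'_def by blast
      then show ?thesis using hed that by metis
    qed
    show ?thesis
      using v u True l by (auto simp: E_def topspace_sigma1 split: if_splits)
  next
    case False
    then show ?thesis using l by (auto simp: E_def topspace_sigma1)
  qed
  have cE: "continuous_map X' X E"
    unfolding X_def continuous_map_componentwise
  proof (intro conjI ballI)
    show "E ` topspace X' \<subseteq> extensional \<Lambda>" by (auto simp: E_def)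
    fix l assume l: "l \<in> \<Lambda>"
    show "continuous_map X' (sigma1 \<Delta>) (\<lambda>z. E z l)"
      unfolding sigma1_def continuous_map_in_subtopology continuous_map_componentwise
    proof (intro conjI ballI)
      show "(\<lambda>z. E z l) ` topspace X' \<subseteq> extensional \<Delta>" using l by (auto simp: E_def)
      show "(\<lambda>z. E z l) \<in> topspace X' \<rightarrow>
          {x. \<forall>d\<in>\<Delta>. \<forall>d'\<in>\<Delta>. x d \<noteq> 0 \<and> x d' \<noteq> 0 \<longrightarrow> d = d'}"
        using EX[OF _ l] by (simp add: topspace_sigma1 Pi_iff)
      fix d assume d: "d \<in> \<Delta>"
      show "continuous_map X' (discrete_topology {0, 1}) (\<lambda>z. E z l d)"
      proof (cases "l \<in> \<Lambda>0 \<and> d \<in> \<Delta>0")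
        case True
        then have "el l \<in> \<Lambda>'" "ed d \<in> \<Delta>'" by (auto simp: \<Lambda>'_def \<Delta>'_def)
        from continuous_map_compose[OF continuous_map_product_projection[OF this(1)]
            continuous_map_sigma1_coord[OF this(2)]]
        show ?thesis using True l d by (simp add: X'_def comp_def E_def)
      next
        case False
        then have "(\<lambda>z. E z l d) = (\<lambda>z. 0)" using l d by (auto simp: E_def)
        then show ?thesis by simp
      qed
    qed
  qed
  have "continuous_map X' K (f \<circ> E)"
    using continuous_map_compose[OF cE] f by (simp add: X_def)
  moreover have "(f \<circ> E) ` topspace X' = topspace K"
  proof
    show "(f \<circ> E) ` topspace X' \<subseteq> topspace K"
      using calculation by (rule continuous_map_image_subset_topspace)
    show "topspace K \<subseteq> (f \<circ> E) ` topspace X'"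
    proof
      fix k assume k: "k \<in> topspace K"
      then obtain x where x: "x \<in> topspace X" "f x = k" using surj by (metis X_def imageE)
      define z where "z = (\<lambda>l'\<in>\<Lambda>'. \<lambda>d'\<in>\<Delta>'. x (hl l') (hd d'))"
      have backl: "hl l' \<in> \<Lambda>" if "l' \<in> \<Lambda>'" for l' using that hel sub by (auto simp: \<Lambda>'_def)
      have backd: "hd d' \<in> \<Delta>" if "d' \<in> \<Delta>'" for d' using that hed sub by (auto simp: \<Delta>'_def)
      have injd: "d' = d''" if "d' \<in> \<Delta>'" "d'' \<in> \<Delta>'" "hd d' = hd d''" for d' d''
        using that hed by (auto simp: \<Delta>'_def)
      have zX: "z \<in> topspace X'"
      proof -
        have "z l' \<in> topspace (sigma1 \<Delta>')" if l': "l' \<in> \<Lambda>'" for l'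
        proof -
          have s: "x (hl l') \<in> topspace (sigma1 \<Delta>)" using x(1) backl[OF l'] by (auto simp: X_def)
          have v: "x (hl l') (hd d') \<in> {0, 1}" if "d' \<in> \<Delta>'" for d'
            using s backd[OF that] unfolding topspace_sigma1 by blast
          have u: "d' = d''" if "d' \<in> \<Delta>'" "d'' \<in> \<Delta>'" "x (hl l') (hd d') \<noteq> 0" "x (hl l') (hd d'') \<noteq> 0" for d' d''
          proof -
            have "hd d' = hd d''" using s backd that unfolding topspace_sigma1 by blast
            then show ?thesis using injd that by blast
          qed
          show ?thesis using v u l' unfolding topspace_sigma1 z_def by auto
        qed
        then show ?thesis by (auto simp: X'_def z_def)
      qed
      have EzX: "E z \<in> topspace X" using cE zX by (auto simp: continuous_map_def)
      have agree: "E z l d = x l d" if "(l, d) \<in> S" for l d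
      proof -
        have m: "l \<in> \<Lambda>0" "d \<in> \<Delta>0" using that by (force simp: \<Lambda>0_def \<Delta>0_def)+
        then have "el l \<in> \<Lambda>'" "ed d \<in> \<Delta>'" "l \<in> \<Lambda>" "d \<in> \<Delta>"
          using sub by (auto simp: \<Lambda>'_def \<Delta>'_def)
        then show ?thesis using m by (simp add: E_def z_def hel hed)
      qed
      have "f (E z) = k"
      proof (rule ccontr)
        assume ne: "f (E z) \<noteq> k"
        have "f (E z) \<in> topspace K" using EzX surj by (auto simp: X_def)
        from sep[OF this k ne EzX x(1) refl x(2)]
        obtain l d where "(l, d) \<in> F (f (E z)) k" "E z l d \<noteq> x l d" by blast
        then show False using agree by (auto simp: S_def)
      qed
      then show "k \<in> (f \<circ> E) ` topspace X'" using zX by force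
    qed
  qed
  ultimately show ?thesis unfolding polyadic_def X'_def by blast
qed

end

theory Submission
  imports Defs "HOL-Library.Countable_Set_Type"
begin

text \<open>
  A graph \<open>G\<close> on a subset of \<open>\<Gamma>\<close> is written into a norm: take the maximum of the norm
  of $\ell_p$ and of all \<open>\<bar>x a\<bar> + \<bar>x b\<bar>\<close>, where \<open>{a, b}\<close> is an edge. The result lies
  between the original norm and twice the original norm. On its unit ball
  consider the slices \<open>V a\<close>, where \<open>x a > 1/2\<close>, and \<open>U a\<close>, where \<open>x a > s\<close>, with
  $1/2 < s < 2^{-1/p}$; such an \<open>s\<close> exists exactly because \<open>p > 1\<close>. Along an edge
  the new term forbids that both coordinates exceed 1/2, so \<open>V a\<close> and \<open>V b\<close> are disjoint.
  Off the edges only the norm of $\ell_p$ restricts the vector $2^{-1/p}(e_a + e_b)$, which has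
  norm 1, so \<open>U a\<close> and \<open>U b\<close> meet. An uncountable disjoint subfamily of \<open>U\<close> is thus an
  uncountable clique of \<open>G\<close>, and an uncountable subfamily of \<open>V\<close> that meets pairwise is an
  uncountable independent set. Sierpinski's graph (\<open>Sierpinski_graph\<close>), which compares a
  well-order with the order of the real line on a set of size $\aleph_1$, has neither.

  For polyadic spaces the required case of Bell's theorem is \<open>polyadic_uncountable_dichotomy\<close>.
  Pulled back to a power of \<open>\<sigma>\<^sub>1(\<Delta>)\<close>, each pair \<open>U a\<close>, \<open>V a\<close> is separated, by compactness,
  by a condition on a finite rectangle of coordinates. Two applications of the
  \<open>\<Delta>\<close>-system lemma make both sides of these rectangles overlap in fixed roots. Whether a point
  for one index and a point for another can be glued together then depends only on finite
  patterns over the roots (\<open>compatible_traces_amalgamate\<close>), so on an uncountable set of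
  indices with the same patterns all pairs behave alike: either all of them meet or all are
  disjoint.
\<close>

section \<open>Sierpinski's graph on a set of size $\aleph_1$\<close>

text \<open>
  The real line contains no uncountable well-ordered chain: each element and its successor
  enclose a rational number, and the intervals between them do not overlap.
\<close>
lemma countable_if_strict_mono_into_reals:
  fixes h :: "'a \<Rightarrow> real"
  assumes r: "Well_order r" and A: "A \<subseteq> Field r"
    and h: "\<And>a b. a \<in> A \<Longrightarrow> b \<in> A \<Longrightarrow> a \<noteq> b \<Longrightarrow> (a, b) \<in> r \<Longrightarrow> h a < h b"
  shows "countable A"
proof -
  interpret wo_rel r by standard (rule r)
  have total: "(a, b) \<in> r \<or> (b, a) \<in> r" if "a \<in> A" "b \<in> A" for a b
    using TOTALS A that by blast
  define above where "above a = {b \<in> A. b \<noteq> a \<and> (a, b) \<in> r}" for a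
  \<comment> \<open>\<open>s a\<close> is the successor of \<open>a\<close> in \<open>A\<close>; it exists unless \<open>a\<close> is the last element.\<close>
  define s where "s a = minim (above a)" for a
  define B where "B = {a \<in> A. above a \<noteq> {}}"
  have s: "s a \<in> above a" "\<And>b. b \<in> above a \<Longrightarrow> (s a, b) \<in> r" if "a \<in> B" for a
  proof -
    have "above a \<subseteq> Field r" "above a \<noteq> {}" using A that by (auto simp: above_def B_def)
    then show "s a \<in> above a" "\<And>b. b \<in> above a \<Longrightarrow> (s a, b) \<in> r"
      unfolding s_def using minim_in minim_least by blast+
  qed
  have "\<exists>q. h a < of_rat q \<and> of_rat q < h (s a)" if "a \<in> B" for a
  proof -
    have "h a < h (s a)" using h[of a "s a"] s(1)[OF that] that by (auto simp: above_def B_def)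
    then show ?thesis by (rule of_rat_dense)
  qed
  then obtain q :: "'a \<Rightarrow> rat" where q: "\<And>a. a \<in> B \<Longrightarrow> h a < of_rat (q a) \<and> of_rat (q a) < h (s a)"
    by metis
  have less: "q a < q b" if "a \<in> B" "b \<in> B" "a \<noteq> b" "(a, b) \<in> r" for a b
  proof -
    have "b \<in> above a" using that by (auto simp: above_def B_def)
    then have "(s a, b) \<in> r" "s a \<in> A" "b \<in> A"
      using s[OF that(1)] by (auto simp: above_def)
    then have "h (s a) \<le> h b" using h[of "s a" b] by fastforce
    then have "real_of_rat (q a) < real_of_rat (q b)" using q[OF that(1)] q[OF that(2)] by linarith
    then show ?thesis by (simp add: of_rat_less)
  qed
  have "inj_on q B"
  proof (rule inj_onI, rule ccontr)
    fix a b assume "a \<in> B" "b \<in> B" "q a = q b" "a \<noteq> b"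
    then show False using less[of a b] less[of b a] total[of a b] by (auto simp: B_def)
  qed
  then have "countable B" by (rule countableI')
  moreover have "countable (A - B)"
  proof (cases "A - B = {}")
    case False
    then obtain a where a: "a \<in> A - B" by (meson equals0I)
    have "b = a" if "b \<in> A - B" for b
      using that a total[of a b] by (auto simp: above_def B_def)
    then have "A - B \<subseteq> {a}" by auto
    then show ?thesis by (meson countable_finite finite.emptyI finite.insertI finite_subset)
  next
    case True
    then show ?thesis by (metis countable_empty)
  qed
  ultimately have "countable (B \<union> (A - B))" by (rule countable_Un)
  moreover have "B \<union> (A - B) = A" by (auto simp: B_def)
  ultimately show ?thesis by simp
qed

text \<open>
  Passing to a subset of size $\aleph_1$ does two jobs below: it makes the index set a regular
  cardinal, and it makes it embed into the real line.
\<close>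
lemma uncountable_subset_card_of_aleph1:
  assumes "uncountable X"
  obtains I where "I \<subseteq> X" and "|I| =o cardSuc natLeq"
proof -
  have "\<not> |X| \<le>o natLeq" using assms by (simp add: countable_card_le_natLeq)
  then have "natLeq <o |X|"
    using not_ordLeq_iff_ordLess[OF natLeq_Well_order card_of_Well_order[of X]] by iprover
  then have le: "cardSuc natLeq \<le>o |X|"
    by (simp add: cardSuc_ordLess_ordLeq[OF natLeq_Card_order card_of_Card_order])
  let ?W = "Field (cardSuc natLeq)"
  have W: "|?W| =o cardSuc natLeq"
    by (rule card_of_Field_ordIso[OF cardSuc_Card_order[OF natLeq_Card_order]])
  obtain f where f: "inj_on f ?W" "f ` ?W \<subseteq> X"
    using ordIso_ordLeq_trans[OF W le] by (auto simp flip: card_of_ordLeq)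
  have "|f ` ?W| =o |?W|"
    using inj_on_imp_bij_betw[OF f(1)] card_of_ordIso ordIso_symmetric by metis
  then have "|f ` ?W| =o cardSuc natLeq" by (rule ordIso_transitive[OF _ W])
  then show thesis by (rule that[OF f(2)])
qed

lemma uncountable_if_aleph1:
  assumes "|I| =o cardSuc natLeq"
  shows "uncountable I"
proof
  assume "countable I"
  then have "|I| \<le>o natLeq" by (simp add: countable_card_le_natLeq)
  with ordIso_symmetric[OF assms] have "cardSuc natLeq \<le>o natLeq" by (rule ordIso_ordLeq_trans)
  then show False using cardSuc_greater[OF natLeq_Card_order] not_ordLess_ordLeq by metis
qed

lemma uncountable_regular_cardinal_aleph1:
  assumes I: "|I| =o cardSuc natLeq"
  shows "uncountable_regular_cardinal |I|"
proof -
  have "regularCard |I|"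
    by (rule regularCard_ordIso[OF ordIso_symmetric[OF I] Cinfinite_cardSuc[OF natLeq_Cinfinite]
        regularCard_cardSuc[OF natLeq_Cinfinite]])
  then show ?thesis
    using uncountable_if_aleph1[OF I]
    by (simp add: uncountable_regular_cardinal_def card_of_card_order_on Field_card_of)
qed

text \<open>
  Join two points when a well-order and an injection into the real line order them in the same
  way. The injection is increasing on cliques and decreasing on independent sets, so both are
  chains in the line that are well-ordered, one upwards and one downwards.
\<close>
lemma Sierpinski_graph:
  assumes "uncountable \<Gamma>"
  obtains I G where "I \<subseteq> \<Gamma>" and "|I| =o cardSuc natLeq" and "symp G" and "irreflp G"
    and "\<forall>A\<subseteq>I. pairwise G A \<longrightarrow> countable A"
    and "\<forall>A\<subseteq>I. pairwise (\<lambda>a b. \<not> G a b) A \<longrightarrow> countable A"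
proof -
  obtain I where I: "I \<subseteq> \<Gamma>" "|I| =o cardSuc natLeq"
    by (rule uncountable_subset_card_of_aleph1[OF assms])
  obtain Y :: "real set" where Y: "|Y| =o cardSuc natLeq"
    by (rule uncountable_subset_card_of_aleph1[OF uncountable_UNIV_real])
  have "|I| =o |Y|" by (rule ordIso_transitive[OF I(2) ordIso_symmetric[OF Y]])
  then obtain g where "bij_betw g I Y" by (auto simp flip: card_of_ordIso)
  then have inj: "inj_on g I" by (rule bij_betw_imp_inj_on)
  define r where "r = |I|"
  have r: "Well_order r" "Field r = I"
    unfolding r_def by (rule card_of_Well_order, rule Field_card_of)
  interpret wo_rel r by standard (rule r)
  have total: "(a, b) \<in> r \<longleftrightarrow> (b, a) \<notin> r" if "a \<in> I" "b \<in> I" "a \<noteq> b" for a b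
    using TOTALS ANTISYM that r(2) by (auto simp: antisym_def)
  have ne: "g a \<noteq> g b" if "a \<in> I" "b \<in> I" "a \<noteq> b" for a b
    using inj that by (auto simp: inj_on_def)
  define G where "G a b \<longleftrightarrow> a \<in> I \<and> b \<in> I \<and> a \<noteq> b \<and> ((a, b) \<in> r \<longleftrightarrow> g a < g b)" for a b
  have "symp G"
  proof (rule sympI)
    fix a b assume "G a b"
    then show "G b a" using total[of a b] ne[of a b] by (auto simp: G_def)
  qed
  moreover have "irreflp G" by (auto intro!: irreflpI simp: G_def)
  moreover have "countable A" if "A \<subseteq> I" "pairwise G A" for A
    using that by (intro countable_if_strict_mono_into_reals[OF r(1), of A g])
      (auto simp: r(2) G_def pairwise_def)
  moreover have "countable A" if A: "A \<subseteq> I" "pairwise (\<lambda>a b. \<not> G a b) A" for A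
  proof (rule countable_if_strict_mono_into_reals[OF r(1), of A "\<lambda>a. - g a"])
    fix a b assume ab: "a \<in> A" "b \<in> A" "a \<noteq> b" "(a, b) \<in> r"
    then have "\<not> g a < g b" using A by (auto simp: pairwise_def G_def)
    then show "- g a < - g b" using ne[of a b] ab A(1) by fastforce
  qed (use A r(2) in auto)
  ultimately show thesis by (intro that[OF I] allI impI) simp_all
qed

section \<open>The $\Delta$-system lemma\<close>

lemma uncountable_fibre:
  assumes "uncountable I" and "countable (h ` I)"
  obtains c where "uncountable {i \<in> I. h i = c}"
proof (cases "\<exists>c. uncountable {i \<in> I. h i = c}")
  case False
  then have "countable (\<Union>c\<in>h ` I. {i \<in> I. h i = c})"
    using assms(2) by (intro countable_UN) auto
  moreover have "(\<Union>c\<in>h ` I. {i \<in> I. h i = c}) = I" by auto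
  ultimately show thesis using assms(1) by simp
qed (elim exE, rule that)

lemma maximal_disjoint_subfamily:
  obtains J where "J \<subseteq> I" and "disjoint_family_on F J"
    and "\<forall>i\<in>I - J. \<exists>j\<in>J. F i \<inter> F j \<noteq> {}"
proof -
  let ?\<A> = "{J. J \<subseteq> I \<and> disjoint_family_on F J}"
  have "\<exists>M\<in>?\<A>. \<forall>X\<in>?\<A>. M \<subseteq> X \<longrightarrow> X = M"
  proof (rule subset_Zorn')
    fix C assume C: "subset.chain ?\<A> C"
    have "F i \<inter> F j = {}" if "X \<in> C" "Y \<in> C" "i \<in> X" "j \<in> Y" "i \<noteq> j" for X Y i j
    proof -
      have "X \<subseteq> Y \<or> Y \<subseteq> X" using C that unfolding subset.chain_def by blast
      moreover have "disjoint_family_on F X" "disjoint_family_on F Y"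
        using C that by (auto simp: subset.chain_def)
      ultimately show ?thesis using that unfolding disjoint_family_on_def by blast
    qed
    then have "disjoint_family_on F (\<Union>C)" by (auto simp: disjoint_family_on_def)
    moreover have "\<Union>C \<subseteq> I" using C by (auto simp: subset.chain_def)
    ultimately show "\<Union>C \<in> ?\<A>" by blast
  qed
  then obtain J where "J \<in> ?\<A>" and "\<forall>X\<in>?\<A>. J \<subseteq> X \<longrightarrow> X = J" by (elim bexE)
  then have J: "J \<subseteq> I" "disjoint_family_on F J"
    and max: "\<And>X. X \<subseteq> I \<Longrightarrow> disjoint_family_on F X \<Longrightarrow> J \<subseteq> X \<Longrightarrow> X = J" by simp_all
  have "\<exists>j\<in>J. F i \<inter> F j \<noteq> {}" if i: "i \<in> I - J" for i
  proof (rule ccontr)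
    assume "\<not> ?thesis"
    then have "disjoint_family_on F (insert i J)"
      using J(2) by (auto simp: disjoint_family_on_def)
    then show False using max[of "insert i J"] J(1) i by blast
  qed
  then show thesis using J that by simp
qed

text \<open>
  If some point lies in uncountably many of the sets, it goes into the root and the induction
  hypothesis applies to the sets without it. Otherwise a maximal disjoint subfamily cannot be
  countable: its union would be countable and would meet all the sets, while each
  of its points meets only countably many.
\<close>
lemma Delta_system_fixed_card:
  assumes "uncountable I" and "\<And>i. i \<in> I \<Longrightarrow> finite (F i) \<and> card (F i) = n"
  shows "\<exists>A R. A \<subseteq> I \<and> uncountable A \<and> (\<forall>i\<in>A. \<forall>j\<in>A. i \<noteq> j \<longrightarrow> F i \<inter> F j = R)"
  using assms
proof (induction n arbitrary: I F)
  case 0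
  then have "\<forall>i\<in>I. \<forall>j\<in>I. i \<noteq> j \<longrightarrow> F i \<inter> F j = {}" by fastforce
  then show ?case using 0(1) by (intro exI[of _ I] exI[of _ "{}"]) auto
next
  case (Suc n)
  show ?case
  proof (cases "\<exists>a. uncountable {i \<in> I. a \<in> F i}")
    case True
    then obtain a where a: "uncountable {i \<in> I. a \<in> F i}" by blast
    have "\<exists>A R. A \<subseteq> {i \<in> I. a \<in> F i} \<and> uncountable A \<and>
        (\<forall>i\<in>A. \<forall>j\<in>A. i \<noteq> j \<longrightarrow> (F i - {a}) \<inter> (F j - {a}) = R)"
      by (rule Suc.IH[OF a]) (use Suc.prems(2) in auto)
    then obtain A R where A: "A \<subseteq> {i \<in> I. a \<in> F i}" "uncountable A"
      and R: "\<forall>i\<in>A. \<forall>j\<in>A. i \<noteq> j \<longrightarrow> (F i - {a}) \<inter> (F j - {a}) = R" by (elim exE conjE)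
    have "F i \<inter> F j = insert a R" if "i \<in> A" "j \<in> A" "i \<noteq> j" for i j
      using that R A(1) by blast
    then show ?thesis
      using A by (intro exI[of _ A] exI[of _ "insert a R"]) auto
  next
    case False
    obtain J where J: "J \<subseteq> I" "disjoint_family_on F J"
      and meets: "\<forall>i\<in>I - J. \<exists>j\<in>J. F i \<inter> F j \<noteq> {}"
      by (rule maximal_disjoint_subfamily[of I F])
    have "uncountable J"
    proof
      assume c: "countable J"
      have "countable (F j)" if "j \<in> J" for j
        using Suc.prems(2) J(1) that by (intro countable_finite) auto
      with c have "countable (\<Union>j\<in>J. F j)" by (rule countable_UN)
      then have "countable (\<Union>a\<in>(\<Union>j\<in>J. F j). {i \<in> I. a \<in> F i})"
        by (rule countable_UN) (use False in simp)
      with c have "countable (J \<union> (\<Union>a\<in>(\<Union>j\<in>J. F j). {i \<in> I. a \<in> F i}))"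
        by (rule countable_Un)
      moreover have "I \<subseteq> J \<union> (\<Union>a\<in>(\<Union>j\<in>J. F j). {i \<in> I. a \<in> F i})"
      proof
        fix i assume "i \<in> I"
        then show "i \<in> J \<union> (\<Union>a\<in>(\<Union>j\<in>J. F j). {i \<in> I. a \<in> F i})"
          using meets by (cases "i \<in> J") force+
      qed
      ultimately have "countable I" by (rule countable_subset[rotated])
      then show False using Suc.prems(1) by simp
    qed
    then show ?thesis
      using J by (intro exI[of _ J] exI[of _ "{}"]) (auto simp: disjoint_family_on_def)
  qed
qed

lemma Delta_system:
  assumes "uncountable I" and "\<And>i. i \<in> I \<Longrightarrow> finite (F i)"
  obtains A R where "A \<subseteq> I" and "uncountable A" and "finite R" and "\<forall>i\<in>A. R \<subseteq> F i"
    and "\<forall>i\<in>A. \<forall>j\<in>A. i \<noteq> j \<longrightarrow> F i \<inter> F j = R"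
proof -
  have "countable ((\<lambda>i. card (F i)) ` I)" by simp
  with assms(1) obtain n where n: "uncountable {i \<in> I. card (F i) = n}"
    by (rule uncountable_fibre)
  have "\<exists>A R. A \<subseteq> {i \<in> I. card (F i) = n} \<and> uncountable A \<and>
      (\<forall>i\<in>A. \<forall>j\<in>A. i \<noteq> j \<longrightarrow> F i \<inter> F j = R)"
    by (rule Delta_system_fixed_card[OF n, where n = n]) (use assms(2) in auto)
  then obtain A R where A: "A \<subseteq> {i \<in> I. card (F i) = n}" "uncountable A"
    and "\<forall>i\<in>A. \<forall>j\<in>A. i \<noteq> j \<longrightarrow> F i \<inter> F j = R" by (elim exE conjE)
  then have AI: "A \<subseteq> I" and R: "\<And>i j. i \<in> A \<Longrightarrow> j \<in> A \<Longrightarrow> i \<noteq> j \<Longrightarrow> F i \<inter> F j = R"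
    by auto
  have sub: "R \<subseteq> F i" if i: "i \<in> A" for i
  proof -
    have "uncountable (A - {i})" using A(2) by (simp add: uncountable_minus_countable)
    then obtain j where "j \<in> A - {i}" by (metis countable_empty equals0I)
    then show ?thesis using R[of i j] i by auto
  qed
  obtain i where "i \<in> A" using A(2) by (metis countable_empty equals0I)
  then have "finite R" using sub[of i] AI assms(2)[of i] finite_subset by auto
  then show thesis using that[OF AI A(2)] R sub by simp
qed

section \<open>Polyadic spaces\<close>

lemma sigma1_value:
  assumes "x \<in> topspace (sigma1 \<Delta>)" "d \<in> \<Delta>"
  shows "x d \<in> {0, 1}"
  using assms unfolding topspace_sigma1 mem_Collect_eq by (elim conjE) (rule PiE_mem)

lemma sigma1_at_most_one:
  assumes "x \<in> topspace (sigma1 \<Delta>)" "d \<in> \<Delta>" "d' \<in> \<Delta>" "x d \<noteq> 0" "x d' \<noteq> 0"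
  shows "d = d'"
  using assms unfolding topspace_sigma1 by blast

lemma openin_sigma1_finite_coordinates:
  assumes W: "openin (sigma1 \<Delta>) W" and x: "x \<in> W"
  shows "\<exists>E. finite E \<and> E \<subseteq> \<Delta> \<and>
    (\<forall>y\<in>topspace (sigma1 \<Delta>). (\<forall>d\<in>E. y d = x d) \<longrightarrow> y \<in> W)"
proof -
  let ?P = "product_topology (\<lambda>_. discrete_topology {0, 1 :: nat}) \<Delta>"
  let ?S = "{x. \<forall>d\<in>\<Delta>. \<forall>d'\<in>\<Delta>. x d \<noteq> 0 \<and> x d' \<noteq> (0 :: nat) \<longrightarrow> d = d'}"
  obtain T where T: "openin ?P T" "W = T \<inter> ?S"
    using W unfolding sigma1_def openin_subtopology by blast
  then obtain U where U: "finite {d \<in> \<Delta>. U d \<noteq> {0, 1 :: nat}}" "x \<in> Pi\<^sub>E \<Delta> U" "Pi\<^sub>E \<Delta> U \<subseteq> T"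
    using x by (auto simp: openin_product_topology_alt)
  have "y \<in> W" if y: "y \<in> topspace (sigma1 \<Delta>)"
    and eq: "\<forall>d\<in>{d \<in> \<Delta>. U d \<noteq> {0, 1}}. y d = x d" for y
  proof -
    have "y d \<in> U d" if "d \<in> \<Delta>" for d
    proof (cases "U d = {0, 1}")
      case True
      then show ?thesis using y that unfolding topspace_sigma1 PiE_iff by simp
    next
      case False
      then show ?thesis using eq U(2) that by auto
    qed
    then have "y \<in> Pi\<^sub>E \<Delta> U" using y unfolding topspace_sigma1 PiE_iff by simp
    moreover have "y \<in> ?S" using y unfolding topspace_sigma1 mem_Collect_eq by (rule conjunct2)
    ultimately show ?thesis unfolding T(2) using U(3) by (intro IntI subsetD[OF U(3)])
  qed
  then show ?thesis
    using U(1) by (intro exI[of _ "{d \<in> \<Delta>. U d \<noteq> {0, 1}}"]) simp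
qed

abbreviation sigma1_power :: "'d set \<Rightarrow> 'l set \<Rightarrow> ('l \<Rightarrow> 'd \<Rightarrow> nat) topology" where
  "sigma1_power \<Delta> \<Lambda> \<equiv> product_topology (\<lambda>_. sigma1 \<Delta>) \<Lambda>"

abbreviation agree :: "'l set \<Rightarrow> 'd set \<Rightarrow> ('l \<Rightarrow> 'd \<Rightarrow> nat) \<Rightarrow> ('l \<Rightarrow> 'd \<Rightarrow> nat) \<Rightarrow> bool" where
  "agree F E x y \<equiv> \<forall>l\<in>F. \<forall>d\<in>E. y l d = x l d"

lemma openin_sigma1_power_finite_coordinates:
  assumes W: "openin (sigma1_power \<Delta> \<Lambda>) W" and x: "x \<in> W"
  shows "\<exists>F E. finite F \<and> F \<subseteq> \<Lambda> \<and> finite E \<and> E \<subseteq> \<Delta> \<and>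
    (\<forall>y\<in>topspace (sigma1_power \<Delta> \<Lambda>). agree F E x y \<longrightarrow> y \<in> W)"
proof -
  obtain U where U: "finite {l \<in> \<Lambda>. U l \<noteq> topspace (sigma1 \<Delta>)}"
      "\<And>l. l \<in> \<Lambda> \<Longrightarrow> openin (sigma1 \<Delta>) (U l)" "x \<in> Pi\<^sub>E \<Lambda> U" "Pi\<^sub>E \<Lambda> U \<subseteq> W"
    using W x by (auto simp: openin_product_topology_alt)
  define F where "F = {l \<in> \<Lambda>. U l \<noteq> topspace (sigma1 \<Delta>)}"
  have "\<exists>E. finite E \<and> E \<subseteq> \<Delta> \<and>
      (\<forall>y\<in>topspace (sigma1 \<Delta>). (\<forall>d\<in>E. y d = x l d) \<longrightarrow> y \<in> U l)" if "l \<in> F" for l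
  proof -
    have "l \<in> \<Lambda>" using that by (simp add: F_def)
    then have "openin (sigma1 \<Delta>) (U l)" "x l \<in> U l" using U(2,3) by auto
    then show ?thesis by (rule openin_sigma1_finite_coordinates)
  qed
  then obtain E where E: "\<And>l. l \<in> F \<Longrightarrow> finite (E l) \<and> E l \<subseteq> \<Delta> \<and>
      (\<forall>y\<in>topspace (sigma1 \<Delta>). (\<forall>d\<in>E l. y d = x l d) \<longrightarrow> y \<in> U l)"
    by metis
  have "y \<in> W" if y: "y \<in> topspace (sigma1_power \<Delta> \<Lambda>)" and eq: "agree F (\<Union>l\<in>F. E l) x y" for y
  proof -
    have "y l \<in> U l" if l: "l \<in> \<Lambda>" for l
    proof (cases "l \<in> F")
      case True
      have "y l \<in> topspace (sigma1 \<Delta>)" using y l by auto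
      then show ?thesis using E[OF True] eq True by auto
    next
      case False
      then show ?thesis using y l by (auto simp: F_def)
    qed
    then have "y \<in> Pi\<^sub>E \<Lambda> U" using y by auto
    then show ?thesis using U(4) by blast
  qed
  moreover have "finite F" "F \<subseteq> \<Lambda>" using U(1) by (auto simp: F_def)
  moreover have "finite (\<Union>l\<in>F. E l)" "(\<Union>l\<in>F. E l) \<subseteq> \<Delta>" using E \<open>finite F\<close> by auto
  ultimately show ?thesis
    by (intro exI[of _ F] exI[of _ "\<Union>l\<in>F. E l"]) simp
qed

lemma openin_sigma1_power_cylinder:
  assumes "finite F" "F \<subseteq> \<Lambda>" "finite E" "E \<subseteq> \<Delta>" "x \<in> topspace (sigma1_power \<Delta> \<Lambda>)"
  shows "openin (sigma1_power \<Delta> \<Lambda>) {y \<in> topspace (sigma1_power \<Delta> \<Lambda>). agree F E x y}"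
proof -
  let ?X = "sigma1_power \<Delta> \<Lambda>"
  have op: "openin ?X {y \<in> topspace ?X. y l d = x l d}" if "l \<in> \<Lambda>" "d \<in> \<Delta>" for l d
  proof -
    have c: "continuous_map ?X (discrete_topology {0, 1}) (\<lambda>y. y l d)"
      using continuous_map_compose[OF continuous_map_product_projection[OF that(1),
            of "\<lambda>_. sigma1 \<Delta>"] continuous_map_sigma1_coord[OF that(2)]]
      unfolding comp_def .
    then have "x l d \<in> {0, 1}"
      using assms(5) continuous_map_image_subset_topspace[OF c] by auto
    then have "openin (discrete_topology {0, 1}) {x l d}" by simp
    from openin_continuous_map_preimage[OF c this] show ?thesis by simp
  qed
  have "openin ?X ((\<Inter>c\<in>F \<times> E. {y \<in> topspace ?X. y (fst c) (snd c) = x (fst c) (snd c)}) \<inter> topspace ?X)"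
    by (intro openin_INT finite_cartesian_product assms op) (use assms in auto)
  also have "(\<Inter>c\<in>F \<times> E. {y \<in> topspace ?X. y (fst c) (snd c) = x (fst c) (snd c)}) \<inter> topspace ?X
      = {y \<in> topspace ?X. agree F E x y}"
    by auto
  finally show ?thesis .
qed

text \<open>
  This replaces a clopen set between \<open>C\<close> and \<open>W\<close>. Compactness covers \<open>C\<close> by finitely
  many cylinders inside \<open>W\<close>, and the coordinates of all of them together form the rectangle.
\<close>
lemma sigma1_power_finite_coordinates:
  assumes C: "closedin (sigma1_power \<Delta> \<Lambda>) C" and W: "openin (sigma1_power \<Delta> \<Lambda>) W"
    and CW: "C \<subseteq> W"
  shows "\<exists>F E. finite F \<and> F \<subseteq> \<Lambda> \<and> finite E \<and> E \<subseteq> \<Delta> \<and>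
    (\<forall>x\<in>C. \<forall>y\<in>topspace (sigma1_power \<Delta> \<Lambda>). agree F E x y \<longrightarrow> y \<in> W)"
proof -
  let ?X = "sigma1_power \<Delta> \<Lambda>"
  have top: "x \<in> topspace ?X" if "x \<in> C" for x using closedin_subset[OF C] that by blast
  have "\<exists>F E. finite F \<and> F \<subseteq> \<Lambda> \<and> finite E \<and> E \<subseteq> \<Delta> \<and>
      (\<forall>y\<in>topspace ?X. agree F E x y \<longrightarrow> y \<in> W)" if "x \<in> C" for x
    by (rule openin_sigma1_power_finite_coordinates[OF W subsetD[OF CW that]])
  then obtain F E where FE: "\<And>x. x \<in> C \<Longrightarrow> finite (F x) \<and> F x \<subseteq> \<Lambda> \<and> finite (E x) \<and> E x \<subseteq> \<Delta> \<and>
      (\<forall>y\<in>topspace ?X. agree (F x) (E x) x y \<longrightarrow> y \<in> W)"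
    by metis
  define cyl where "cyl x = {y \<in> topspace ?X. agree (F x) (E x) x y}" for x
  have "compact_space ?X" by (simp add: compact_space_product_topology compact_space_sigma1)
  then have comp: "compactin ?X C" using C by (rule closedin_compact_space)
  have op: "openin ?X (cyl x)" if "x \<in> C" for x
    unfolding cyl_def using FE[OF that] top[OF that] by (intro openin_sigma1_power_cylinder) auto
  have "C \<subseteq> \<Union>(cyl ` C)" using top by (auto simp: cyl_def)
  with comp op obtain \<F> where \<F>: "finite \<F>" "\<F> \<subseteq> cyl ` C" "C \<subseteq> \<Union>\<F>"
    using compactinD[OF comp, of "cyl ` C"] by auto
  obtain Y where Y: "Y \<subseteq> C" "finite Y" "\<F> = cyl ` Y"
    using finite_subset_image[OF \<F>(1,2)] by blast
  have "z \<in> W" if x: "x \<in> C" and z: "z \<in> topspace ?X"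
    and eq: "agree (\<Union>x\<in>Y. F x) (\<Union>x\<in>Y. E x) x z" for x z
  proof -
    obtain y where y: "y \<in> Y" "x \<in> cyl y" using \<F>(3) x unfolding Y(3) by blast
    have "agree (F y) (E y) y z"
    proof (intro ballI)
      fix l d assume "l \<in> F y" "d \<in> E y"
      then have "z l d = x l d" "x l d = y l d" using eq y by (auto simp: cyl_def)
      then show "z l d = y l d" by simp
    qed
    then show ?thesis using FE[of y] y(1) Y(1) z by auto
  qed
  moreover have "finite (\<Union>x\<in>Y. F x)" "(\<Union>x\<in>Y. F x) \<subseteq> \<Lambda>" "finite (\<Union>x\<in>Y. E x)" "(\<Union>x\<in>Y. E x) \<subseteq> \<Delta>"
    using FE Y(1,2) by (auto simp: subset_iff)
  ultimately show ?thesis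
    by (intro exI[of _ "\<Union>x\<in>Y. F x"] exI[of _ "\<Union>x\<in>Y. E x"]) simp
qed

text \<open>
  What has to be remembered of a point \<open>x\<close> that is tested on columns \<open>E\<close>, when rows in the
  root \<open>R\<close> and columns in the root \<open>S\<close> are shared with other indices: for each shared row,
  the position of its 1 if that is a shared column, and whether the 1 lies in \<open>E\<close> at all. The
  exact column inside \<open>E - S\<close> is forgotten, which leaves only finitely many traces.
\<close>
definition root_trace :: "'l set \<Rightarrow> 'd set \<Rightarrow> 'd set \<Rightarrow> ('l \<Rightarrow> 'd \<Rightarrow> nat) \<Rightarrow> 'l \<Rightarrow> 'd set \<times> bool" where
  "root_trace R S E x = (\<lambda>l\<in>R. ({d \<in> S. x l d \<noteq> 0}, \<exists>d\<in>E. x l d \<noteq> 0))"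

text \<open>
  The second clause excludes two private columns in the same row: a row of a point of
  \<open>\<sigma>\<^sub>1\<close> has at most one 1.
\<close>
definition compatible :: "'l set \<Rightarrow> ('l \<Rightarrow> 'd set \<times> bool) \<Rightarrow> ('l \<Rightarrow> 'd set \<times> bool) \<Rightarrow> bool" where
  "compatible R s t \<longleftrightarrow>
     (\<forall>l\<in>R. fst (s l) = fst (t l) \<and> (fst (s l) = {} \<longrightarrow> \<not> (snd (s l) \<and> snd (t l))))"

text \<open>
  If no 1 lies in a shared column, a row of \<open>z\<close> with a 1 in \<open>E\<close> and a 1 in \<open>E'\<close> would have
  two of them, since \<open>E\<close> and \<open>E'\<close> overlap only in \<open>S\<close>.
\<close>
lemma compatible_traces_of_point:
  assumes z: "z \<in> topspace (sigma1_power \<Delta> \<Lambda>)" and R: "R \<subseteq> \<Lambda>"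
    and E: "E \<subseteq> \<Delta>" "E' \<subseteq> \<Delta>" "E \<inter> E' = S"
  shows "compatible R (root_trace R S E z) (root_trace R S E' z)"
  unfolding compatible_def
proof (intro ballI conjI impI notI)
  fix l assume l: "l \<in> R"
  show "fst (root_trace R S E z l) = fst (root_trace R S E' z l)" using l by (simp add: root_trace_def)
  assume "fst (root_trace R S E z l) = {}" "snd (root_trace R S E z l) \<and> snd (root_trace R S E' z l)"
  then obtain d d' where d: "d \<in> E" "d' \<in> E'" "z l d \<noteq> 0" "z l d' \<noteq> 0" "\<And>e. e \<in> S \<Longrightarrow> z l e = 0"
    using l by (auto simp: root_trace_def)
  have "z l \<in> topspace (sigma1 \<Delta>)" using z l R by auto
  then have "d = d'" using d E by (intro sigma1_at_most_one[of "z l" \<Delta>]) auto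
  then have "d \<in> S" using d(1,2) E(3) by auto
  then show False using d(3) d(5)[of d] by simp
qed

text \<open>
  The point \<open>z\<close> carries the ones of \<open>x\<close> in \<open>F \<times> E\<close>, those of \<open>y\<close> in \<open>F' \<times> E'\<close>, and no
  others. Only rows in the root can receive ones from both sides, and there compatibility forces the
  two ones to be the same.
\<close>
lemma compatible_traces_amalgamate:
  assumes x: "x \<in> topspace (sigma1_power \<Delta> \<Lambda>)" and y: "y \<in> topspace (sigma1_power \<Delta> \<Lambda>)"
    and F: "F \<subseteq> \<Lambda>" "F' \<subseteq> \<Lambda>" "F \<inter> F' = R" and E: "E \<subseteq> \<Delta>" "E' \<subseteq> \<Delta>" "E \<inter> E' = S"
    and comp: "compatible R (root_trace R S E x) (root_trace R S E' y)"
  obtains z where "z \<in> topspace (sigma1_power \<Delta> \<Lambda>)" and "agree F E x z" and "agree F' E' y z"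
proof -
  define P where "P l d \<longleftrightarrow>
    (l \<in> F \<and> d \<in> E \<and> x l d \<noteq> 0) \<or> (l \<in> F' \<and> d \<in> E' \<and> y l d \<noteq> 0)" for l d
  define z where "z = (\<lambda>l\<in>\<Lambda>. \<lambda>d\<in>\<Delta>. if P l d then 1 else 0 :: nat)"
  have xs: "x l \<in> topspace (sigma1 \<Delta>)" and ys: "y l \<in> topspace (sigma1 \<Delta>)" if "l \<in> \<Lambda>" for l
    using x y that by auto
  have x01: "x l d \<in> {0, 1}" and y01: "y l d \<in> {0, 1}" if "l \<in> \<Lambda>" "d \<in> \<Delta>" for l d
    using sigma1_value[OF xs[OF that(1)] that(2)] sigma1_value[OF ys[OF that(1)] that(2)] .
  have xu: "d = e" if "l \<in> \<Lambda>" "d \<in> \<Delta>" "e \<in> \<Delta>" "x l d \<noteq> 0" "x l e \<noteq> 0" for l d e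
    using sigma1_at_most_one[OF xs[OF that(1)] that(2-5)] .
  have yu: "d = e" if "l \<in> \<Lambda>" "d \<in> \<Delta>" "e \<in> \<Delta>" "y l d \<noteq> 0" "y l e \<noteq> 0" for l d e
    using sigma1_at_most_one[OF ys[OF that(1)] that(2-5)] .
  \<comment> \<open>In the shared part of both rectangles the two points prescribe the same values.\<close>
  have root: "x l d \<noteq> 0 \<longleftrightarrow> y l d \<noteq> 0" if "l \<in> F" "l \<in> F'" "d \<in> E" "d \<in> E'" for l d
  proof -
    have "l \<in> R" "d \<in> S" using that F(3) E(3) by auto
    then have "{d \<in> S. x l d \<noteq> 0} = {d \<in> S. y l d \<noteq> 0}"
      using comp by (auto simp: compatible_def root_trace_def)
    then show ?thesis using \<open>d \<in> S\<close> by blast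
  qed
  \<comment> \<open>Ones of both points in a shared row: by compatibility one of them is shared, hence they agree.\<close>
  have mix: "d = e" if "l \<in> F" "d \<in> E" "x l d \<noteq> 0" "l \<in> F'" "e \<in> E'" "y l e \<noteq> 0" for l d e
  proof -
    have l: "l \<in> R" "l \<in> \<Lambda>" using that F by auto
    have "\<exists>c\<in>S. x l c \<noteq> 0"
    proof (rule ccontr)
      assume "\<not> ?thesis"
      then have "fst (root_trace R S E x l) = {}" "snd (root_trace R S E x l)" "snd (root_trace R S E' y l)"
        using l that by (auto simp: root_trace_def)
      then show False using comp l by (auto simp: compatible_def)
    qed
    then obtain c where c: "c \<in> S" "x l c \<noteq> 0" by blast
    then have "c \<in> E" "c \<in> E'" using E(3) by auto
    then have "y l c \<noteq> 0" using root that c by blast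
    have "d = c" using xu[OF l(2), of d c] c(2) \<open>c \<in> E\<close> that E(1) by auto
    moreover have "e = c" using yu[OF l(2), of e c] \<open>y l c \<noteq> 0\<close> \<open>c \<in> E'\<close> that E(2) by auto
    ultimately show ?thesis by simp
  qed
  have uniq: "d = e" if "P l d" "P l e" for l d e
    using that unfolding P_def
  proof (elim disjE conjE)
    assume "l \<in> F" "d \<in> E" "e \<in> E" "x l d \<noteq> 0" "x l e \<noteq> 0"
    then show ?thesis using xu[of l d e] F(1) E(1) by (simp add: subset_iff)
  next
    assume "l \<in> F'" "d \<in> E'" "e \<in> E'" "y l d \<noteq> 0" "y l e \<noteq> 0"
    then show ?thesis using yu[of l d e] F(2) E(2) by (simp add: subset_iff)
  qed (simp_all add: mix mix[symmetric])
  have "z l \<in> topspace (sigma1 \<Delta>)" if "l \<in> \<Lambda>" for l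
  proof -
    have "z l \<in> \<Delta> \<rightarrow>\<^sub>E {0, 1}" using that by (auto simp: z_def)
    moreover have "P l d" if "d \<in> \<Delta>" "z l d \<noteq> 0" for d
      using that \<open>l \<in> \<Lambda>\<close> by (simp add: z_def split: if_splits)
    ultimately show ?thesis unfolding topspace_sigma1 using uniq by blast
  qed
  then have "z \<in> topspace (sigma1_power \<Delta> \<Lambda>)" by (auto simp: z_def)
  moreover have "agree F E x z"
  proof (intro ballI)
    fix l d assume ld: "l \<in> F" "d \<in> E"
    then have "l \<in> \<Lambda>" "d \<in> \<Delta>" "P l d \<longleftrightarrow> x l d \<noteq> 0"
      using F(1) E(1) root[of l d] by (auto simp: P_def)
    then show "z l d = x l d" using x01[of l d] by (auto simp: z_def)
  qed
  moreover have "agree F' E' y z"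
  proof (intro ballI)
    fix l d assume ld: "l \<in> F'" "d \<in> E'"
    then have "l \<in> \<Lambda>" "d \<in> \<Delta>" "P l d \<longleftrightarrow> y l d \<noteq> 0"
      using F(2) E(2) root[of l d] by (auto simp: P_def)
    then show "z l d = y l d" using y01[of l d] by (auto simp: z_def)
  qed
  ultimately show thesis by (rule that)
qed

text \<open>
  For two indices with the same set of traces, \<open>C i\<close> and \<open>C j\<close> can only meet if two
  of these traces are compatible, and compatible traces make \<open>W i\<close> and \<open>W j\<close> meet. Hence the
  common set of traces alone decides which alternative holds for all pairs.
\<close>
lemma sigma1_power_closed_open_dichotomy:
  assumes I: "uncountable I"
    and C: "\<And>i. i \<in> I \<Longrightarrow> closedin (sigma1_power \<Delta> \<Lambda>) (C i)"
    and W: "\<And>i. i \<in> I \<Longrightarrow> openin (sigma1_power \<Delta> \<Lambda>) (W i)"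
    and CW: "\<And>i. i \<in> I \<Longrightarrow> C i \<subseteq> W i"
  obtains A where "A \<subseteq> I" and "uncountable A" and "pairwise (\<lambda>i j. C i \<inter> C j = {}) A"
  | A where "A \<subseteq> I" and "uncountable A" and "pairwise (\<lambda>i j. W i \<inter> W j \<noteq> {}) A"
proof -
  let ?X = "sigma1_power \<Delta> \<Lambda>"
  have "\<exists>F E. finite F \<and> F \<subseteq> \<Lambda> \<and> finite E \<and> E \<subseteq> \<Delta> \<and>
      (\<forall>x\<in>C i. \<forall>y\<in>topspace ?X. agree F E x y \<longrightarrow> y \<in> W i)" if "i \<in> I" for i
    using sigma1_power_finite_coordinates[OF C[OF that] W[OF that] CW[OF that]] .
  then obtain F E where FE: "\<And>i. i \<in> I \<Longrightarrow> finite (F i) \<and> F i \<subseteq> \<Lambda> \<and> finite (E i) \<and> E i \<subseteq> \<Delta> \<and>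
      (\<forall>x\<in>C i. \<forall>y\<in>topspace ?X. agree (F i) (E i) x y \<longrightarrow> y \<in> W i)"
    by metis
  have top: "C i \<subseteq> topspace ?X" if "i \<in> I" for i by (rule closedin_subset[OF C[OF that]])
  obtain I1 R where I1: "I1 \<subseteq> I" "uncountable I1" and R: "finite R" "\<forall>i\<in>I1. R \<subseteq> F i"
      "\<forall>i\<in>I1. \<forall>j\<in>I1. i \<noteq> j \<longrightarrow> F i \<inter> F j = R"
    by (rule Delta_system[OF I, of F]) (use FE in simp)
  have "finite (E i)" if "i \<in> I1" for i using FE I1(1) that by blast
  then obtain I2 S where I2: "I2 \<subseteq> I1" "uncountable I2" and S: "finite S" "\<forall>i\<in>I2. S \<subseteq> E i"
      "\<forall>i\<in>I2. \<forall>j\<in>I2. i \<noteq> j \<longrightarrow> E i \<inter> E j = S"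
    by (rule Delta_system[OF I1(2), of E])
  define T where "T i = root_trace R S (E i) ` C i" for i
  have "T i \<subseteq> R \<rightarrow>\<^sub>E Pow S \<times> UNIV" for i by (auto simp: T_def root_trace_def)
  then have "T ` I2 \<subseteq> Pow (R \<rightarrow>\<^sub>E Pow S \<times> UNIV)" by blast
  moreover have "finite (R \<rightarrow>\<^sub>E Pow S \<times> (UNIV :: bool set))"
    using R(1) S(1) by (intro finite_PiE) auto
  ultimately have "countable (T ` I2)" by (meson countable_finite finite_Pow_iff finite_subset)
  with I2(2) obtain T0 where unc: "uncountable {i \<in> I2. T i = T0}" by (rule uncountable_fibre)
  define A where "A = {i \<in> I2. T i = T0}"
  have AI: "A \<subseteq> I" and A: "\<And>i. i \<in> A \<Longrightarrow> i \<in> I \<and> i \<in> I1 \<and> i \<in> I2 \<and> T i = T0"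
    using I1(1) I2(1) by (auto simp: A_def)
  show thesis
  proof (cases "\<exists>s\<in>T0. \<exists>t\<in>T0. compatible R s t")
    case True
    then obtain s t where st: "s \<in> T0" "t \<in> T0" "compatible R s t" by blast
    have "W i \<inter> W j \<noteq> {}" if ij: "i \<in> A" "j \<in> A" "i \<noteq> j" for i j
    proof -
      obtain x where x: "x \<in> C i" "s = root_trace R S (E i) x" using st(1) A[OF ij(1)] by (auto simp: T_def)
      obtain y where y: "y \<in> C j" "t = root_trace R S (E j) y" using st(2) A[OF ij(2)] by (auto simp: T_def)
      have i: "i \<in> I" "i \<in> I1" "i \<in> I2" and j: "j \<in> I" "j \<in> I1" "j \<in> I2" using A ij by auto
      have xy: "x \<in> topspace ?X" "y \<in> topspace ?X" using x y top i j by auto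
      obtain z where z: "z \<in> topspace ?X" "agree (F i) (E i) x z" "agree (F j) (E j) y z"
      proof (rule compatible_traces_amalgamate[OF xy, of "F i" "F j" R "E i" "E j" S])
        show "compatible R (root_trace R S (E i) x) (root_trace R S (E j) y)" using st(3) x y by simp
      qed (use FE i j R(3) S(3) ij(3) in auto)
      have "z \<in> W i" using FE[OF i(1)] x(1) z by blast
      moreover have "z \<in> W j" using FE[OF j(1)] y(1) z by blast
      ultimately show ?thesis by blast
    qed
    then have "pairwise (\<lambda>i j. W i \<inter> W j \<noteq> {}) A" by (auto simp: pairwise_def)
    then show thesis using that(2)[OF AI] unc by (simp add: A_def)
  next
    case False
    have "C i \<inter> C j = {}" if ij: "i \<in> A" "j \<in> A" "i \<noteq> j" for i j
    proof (rule ccontr)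
      assume "C i \<inter> C j \<noteq> {}"
      then obtain z where z: "z \<in> C i" "z \<in> C j" by blast
      have i: "i \<in> I" "i \<in> I1" "i \<in> I2" and j: "j \<in> I" "j \<in> I1" "j \<in> I2" using A ij by auto
      have "compatible R (root_trace R S (E i) z) (root_trace R S (E j) z)"
      proof (rule compatible_traces_of_point[of z \<Delta> \<Lambda>])
        show "R \<subseteq> \<Lambda>" using R(2) i(2) FE[OF i(1)] by blast
      qed (use z top FE i j S(3) ij(3) in auto)
      moreover have "root_trace R S (E i) z \<in> T0" "root_trace R S (E j) z \<in> T0"
        using A[OF ij(1)] A[OF ij(2)] z by (auto simp: T_def)
      ultimately show False using False by blast
    qed
    then have "pairwise (\<lambda>i j. C i \<inter> C j = {}) A" by (auto simp: pairwise_def)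
    then show thesis using that(1)[OF AI] unc by (simp add: A_def)
  qed
qed

text \<open>
  Surjectivity of the map onto \<open>K\<close> turns disjoint preimages into disjoint sets, which carries
  the dichotomy from the power of \<open>\<sigma>\<^sub>1\<close> over to \<open>K\<close>. For index sets of size $\aleph_1$ this is
  Bell's theorem.
\<close>
theorem polyadic_uncountable_dichotomy:
  assumes "polyadic K" and I: "uncountable I"
    and U: "\<And>i. i \<in> I \<Longrightarrow> openin K (U i)" and V: "\<And>i. i \<in> I \<Longrightarrow> openin K (V i)"
    and UV: "\<And>i. i \<in> I \<Longrightarrow> K closure_of U i \<subseteq> V i"
  obtains A where "A \<subseteq> I" and "uncountable A" and "pairwise (\<lambda>i j. U i \<inter> U j = {}) A"
  | A where "A \<subseteq> I" and "uncountable A" and "pairwise (\<lambda>i j. V i \<inter> V j \<noteq> {}) A"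
proof -
  obtain \<Delta> \<Lambda> :: "('a \<times> 'a \<times> nat) set" and f
    where f: "continuous_map (sigma1_power \<Delta> \<Lambda>) K f"
      and onto: "f ` topspace (sigma1_power \<Delta> \<Lambda>) = topspace K"
    using assms(1) unfolding polyadic_def by (elim exE conjE)
  let ?X = "sigma1_power \<Delta> \<Lambda>"
  define C where "C i = {x \<in> topspace ?X. f x \<in> K closure_of U i}" for i
  define W where "W i = {x \<in> topspace ?X. f x \<in> V i}" for i
  have C: "closedin ?X (C i)" for i
    unfolding C_def by (rule closedin_continuous_map_preimage[OF f closedin_closure_of])
  have W: "openin ?X (W i)" if "i \<in> I" for i
    unfolding W_def by (rule openin_continuous_map_preimage[OF f V[OF that]])
  have CW: "C i \<subseteq> W i" if "i \<in> I" for i using UV[OF that] by (auto simp: C_def W_def)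
  have disj: "U i \<inter> U j = {}" if "i \<in> I" "j \<in> I" "C i \<inter> C j = {}" for i j
  proof (rule ccontr)
    assume "U i \<inter> U j \<noteq> {}"
    then obtain k where k: "k \<in> U i" "k \<in> U j" by blast
    have "U i \<subseteq> K closure_of U i" "U j \<subseteq> K closure_of U j"
      by (intro closure_of_subset openin_subset U that)+
    moreover have "k \<in> topspace K" using k(1) openin_subset[OF U[OF that(1)]] by blast
    then have "k \<in> f ` topspace ?X" by (simp only: onto)
    then obtain x where "k = f x" "x \<in> topspace ?X" by (elim imageE)
    ultimately have "x \<in> C i \<inter> C j"
      using k unfolding C_def by blast
    then show False using that(3) by blast
  qed
  show thesis
  proof (rule sigma1_power_closed_open_dichotomy[OF I C W CW])
    fix A assume "A \<subseteq> I" "uncountable A" "pairwise (\<lambda>i j. C i \<inter> C j = {}) A"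
    moreover from this(1,3) have "pairwise (\<lambda>i j. U i \<inter> U j = {}) A"
      unfolding pairwise_def using disj by (simp add: subset_iff)
    ultimately show thesis using that(1) by simp
  next
    fix A assume "A \<subseteq> I" "uncountable A" "pairwise (\<lambda>i j. W i \<inter> W j \<noteq> {}) A"
    moreover from this(3) have "pairwise (\<lambda>i j. V i \<inter> V j \<noteq> {}) A"
      unfolding pairwise_def W_def by blast
    ultimately show thesis using that(2) by simp
  qed
qed

section \<open>The space $\ell_p(\Gamma)$\<close>

lemma powr_convex_combination:
  fixes u v s t p :: real
  assumes "1 \<le> p" "0 \<le> u" "0 \<le> v" "u + v = 1" "0 \<le> s" "0 \<le> t"
  shows "(u * s + v * t) powr p \<le> u * s powr p + v * t powr p"
proof -
  \<comment> \<open>This settles the cases in which one of the two arguments is 0.\<close>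
  have le: "c powr p \<le> c" if "0 \<le> c" "c \<le> 1" for c :: real
    using powr_mono'[of 1 p c] that assms(1) by (cases "c = 0") auto
  consider "s = 0" | "t = 0" | "0 < s" "0 < t" using assms(5,6) by fastforce
  then show ?thesis
  proof cases
    case 1
    then show ?thesis using assms le[of v] by (simp add: powr_mult mult_right_mono)
  next
    case 2
    then show ?thesis using assms le[of u] by (simp add: powr_mult mult_right_mono)
  next
    case 3
    then show ?thesis
      using convex_onD[OF powr_convex[OF assms(1)], of v s t] assms by (simp add: eq_diff_eq[symmetric] add.commute)
  qed
qed

lemma lp_iff: "x \<in> lp \<Gamma> p \<longleftrightarrow>
    (\<forall>\<gamma>. \<gamma> \<notin> \<Gamma> \<longrightarrow> x \<gamma> = 0) \<and> (\<lambda>\<gamma>. \<bar>x \<gamma>\<bar> powr p) summable_on \<Gamma>"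
  by (simp add: lp_def)

lemma lp_scale:
  assumes "x \<in> lp \<Gamma> p"
  shows "(\<lambda>\<gamma>. c * x \<gamma>) \<in> lp \<Gamma> p"
  using assms by (simp add: lp_iff abs_mult powr_mult summable_on_cmult_right)

lemma lp_norm_nonneg: "0 \<le> lp_norm \<Gamma> p x"
  by (simp add: lp_norm_def)

lemma lp_norm_scale:
  assumes "1 \<le> p"
  shows "lp_norm \<Gamma> p (\<lambda>\<gamma>. c * x \<gamma>) = \<bar>c\<bar> * lp_norm \<Gamma> p x"
proof -
  have "(\<Sum>\<^sub>\<infinity>\<gamma>\<in>\<Gamma>. \<bar>c * x \<gamma>\<bar> powr p) = \<bar>c\<bar> powr p * (\<Sum>\<^sub>\<infinity>\<gamma>\<in>\<Gamma>. \<bar>x \<gamma>\<bar> powr p)"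
    by (simp add: abs_mult powr_mult infsum_cmult_right')
  then show ?thesis using assms
    by (simp add: lp_norm_def powr_mult infsum_nonneg powr_powr)
qed

lemma abs_le_lp_norm:
  assumes "x \<in> lp \<Gamma> p" "1 \<le> p" "\<gamma> \<in> \<Gamma>"
  shows "\<bar>x \<gamma>\<bar> \<le> lp_norm \<Gamma> p x"
proof -
  have "(\<Sum>\<^sub>\<infinity>\<gamma>\<in>{\<gamma>}. \<bar>x \<gamma>\<bar> powr p) \<le> (\<Sum>\<^sub>\<infinity>\<gamma>\<in>\<Gamma>. \<bar>x \<gamma>\<bar> powr p)"
    using assms by (intro infsum_mono2) (auto simp: lp_iff)
  then have "\<bar>x \<gamma>\<bar> powr p \<le> (\<Sum>\<^sub>\<infinity>\<gamma>\<in>\<Gamma>. \<bar>x \<gamma>\<bar> powr p)" by simp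
  then have "(\<bar>x \<gamma>\<bar> powr p) powr (1 / p) \<le> lp_norm \<Gamma> p x"
    unfolding lp_norm_def using assms(2) by (intro powr_mono2) auto
  then show ?thesis using assms(2) by (simp add: powr_powr)
qed

lemma infsum_powr_eq_lp_norm_powr:
  assumes "1 \<le> p"
  shows "(\<Sum>\<^sub>\<infinity>\<gamma>\<in>\<Gamma>. \<bar>x \<gamma>\<bar> powr p) = lp_norm \<Gamma> p x powr p"
  using assms by (simp add: lp_norm_def powr_powr infsum_nonneg)

lemma lp_norm_eq_0_iff:
  assumes x: "x \<in> lp \<Gamma> p" and p: "1 \<le> p"
  shows "lp_norm \<Gamma> p x = 0 \<longleftrightarrow> x = (\<lambda>_. 0)"
proof
  assume "lp_norm \<Gamma> p x = 0"
  then have "x \<gamma> = 0" for \<gamma>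
    using x abs_le_lp_norm[OF x p, of \<gamma>] by (cases "\<gamma> \<in> \<Gamma>") (auto simp: lp_iff)
  then show "x = (\<lambda>_. 0)" by auto
qed (simp add: lp_norm_def)

text \<open>
  With \<open>a\<close> and \<open>b\<close> the norms of \<open>x\<close> and \<open>y\<close>, the sum is \<open>a + b\<close> times a convex combination,
  with weights \<open>a / (a + b)\<close> and \<open>b / (a + b)\<close>, of two functions of norm 1. Convexity of
  the \<open>p\<close>-th power, applied at each index, bounds the \<open>p\<close>-th power of its norm by 1.
\<close>
lemma lp_add_Minkowski:
  assumes x: "x \<in> lp \<Gamma> p" and y: "y \<in> lp \<Gamma> p" and p: "1 \<le> p"
  shows "(\<lambda>\<gamma>. x \<gamma> + y \<gamma>) \<in> lp \<Gamma> p \<and>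
    lp_norm \<Gamma> p (\<lambda>\<gamma>. x \<gamma> + y \<gamma>) \<le> lp_norm \<Gamma> p x + lp_norm \<Gamma> p y"
proof (cases "lp_norm \<Gamma> p x = 0 \<or> lp_norm \<Gamma> p y = 0")
  case True
  then show ?thesis
    using x y lp_norm_eq_0_iff[OF x p] lp_norm_eq_0_iff[OF y p] lp_norm_nonneg[of \<Gamma> p] by auto
next
  case False
  define a b where "a = lp_norm \<Gamma> p x" and "b = lp_norm \<Gamma> p y"
  have ab: "0 < a" "0 < b" using False lp_norm_nonneg[of \<Gamma> p] by (auto simp: a_def b_def order_less_le)
  define u v where "u = a / (a + b)" and "v = b / (a + b)"
  have uv: "0 \<le> u" "0 \<le> v" "u + v = 1" using ab by (auto simp: u_def v_def add_divide_distrib[symmetric])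
  let ?X = "\<lambda>\<gamma>. \<bar>x \<gamma>\<bar> powr p" and ?Y = "\<lambda>\<gamma>. \<bar>y \<gamma>\<bar> powr p"
  let ?Z = "\<lambda>\<gamma>. \<bar>x \<gamma> + y \<gamma>\<bar> powr p"
  define K where "K = (a + b) powr p"
  \<comment> \<open>The bound at \<open>\<gamma>\<close> that convexity gives; its sum over \<open>\<Gamma>\<close> is exactly \<open>K\<close>.\<close>
  let ?B = "\<lambda>\<gamma>. K * (u * (?X \<gamma> / a powr p) + v * (?Y \<gamma> / b powr p))"
  have le: "?Z \<gamma> \<le> ?B \<gamma>" for \<gamma>
  proof -
    have "\<bar>x \<gamma> + y \<gamma>\<bar> \<le> (a + b) * (u * (\<bar>x \<gamma>\<bar> / a) + v * (\<bar>y \<gamma>\<bar> / b))"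
      using ab by (simp add: u_def v_def distrib_left)
    then have "?Z \<gamma> \<le> ((a + b) * (u * (\<bar>x \<gamma>\<bar> / a) + v * (\<bar>y \<gamma>\<bar> / b))) powr p"
      using p by (intro powr_mono2) auto
    also have "\<dots> = K * (u * (\<bar>x \<gamma>\<bar> / a) + v * (\<bar>y \<gamma>\<bar> / b)) powr p"
      using ab uv by (simp add: K_def powr_mult)
    also have "\<dots> \<le> K * (u * (\<bar>x \<gamma>\<bar> / a) powr p + v * (\<bar>y \<gamma>\<bar> / b) powr p)"
      using ab uv p by (intro mult_left_mono powr_convex_combination) (auto simp: K_def)
    also have "\<dots> = ?B \<gamma>" using ab by (simp add: powr_divide)
    finally show ?thesis .
  qed
  have sX: "?X summable_on \<Gamma>" and sY: "?Y summable_on \<Gamma>" using x y by (auto simp: lp_iff)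
  have hX: "(?X has_sum a powr p) \<Gamma>" and hY: "(?Y has_sum b powr p) \<Gamma>"
    using has_sum_infsum[OF sX] has_sum_infsum[OF sY]
    by (simp_all add: a_def b_def infsum_powr_eq_lp_norm_powr[OF p])
  have "((\<lambda>\<gamma>. K * (u * (1 / a powr p * ?X \<gamma>) + v * (1 / b powr p * ?Y \<gamma>))) has_sum
      K * (u * (1 / a powr p * a powr p) + v * (1 / b powr p * b powr p))) \<Gamma>"
    by (intro has_sum_cmult_right has_sum_add hX hY)
  then have hB: "(?B has_sum K) \<Gamma>" using ab uv by simp
  have sZ: "?Z summable_on \<Gamma>"
    by (rule summable_on_comparison_test[OF has_sum_imp_summable[OF hB]]) (use le in auto)
  have "(\<Sum>\<^sub>\<infinity>\<gamma>\<in>\<Gamma>. ?Z \<gamma>) \<le> (\<Sum>\<^sub>\<infinity>\<gamma>\<in>\<Gamma>. ?B \<gamma>)"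
    by (rule infsum_mono[OF sZ has_sum_imp_summable[OF hB] le])
  also have "\<dots> = K" by (rule infsumI[OF hB])
  finally have "lp_norm \<Gamma> p (\<lambda>\<gamma>. x \<gamma> + y \<gamma>) \<le> K powr (1 / p)"
    unfolding lp_norm_def using p by (intro powr_mono2) (auto intro: infsum_nonneg)
  also have "\<dots> = a + b" using p ab by (simp add: K_def powr_powr)
  finally show ?thesis using sZ x y by (auto simp: lp_iff a_def b_def)
qed

lemmas lp_add = lp_add_Minkowski[THEN conjunct1]
  and lp_norm_triangle = lp_add_Minkowski[THEN conjunct2]

lemma lp_diff:
  assumes "x \<in> lp \<Gamma> p" "y \<in> lp \<Gamma> p" "1 \<le> p"
  shows "(\<lambda>\<gamma>. x \<gamma> - y \<gamma>) \<in> lp \<Gamma> p"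
  using lp_add[OF assms(1) lp_scale[OF assms(2), of "-1"] assms(3)] by simp

lemma is_norm_on_lp_norm: "1 \<le> p \<Longrightarrow> is_norm_on (lp \<Gamma> p) (lp_norm \<Gamma> p)"
  by (simp add: is_norm_on_def lp_norm_nonneg lp_norm_eq_0_iff lp_norm_scale lp_norm_triangle)

text \<open>
  The axioms of a metric space ask for a nonnegative and symmetric distance on the whole type, not
  only on the carrier, whereas a norm is only controlled on its space.
\<close>
definition even_nonneg :: "(('g \<Rightarrow> real) \<Rightarrow> real) \<Rightarrow> bool" where
  "even_nonneg N \<longleftrightarrow> (\<forall>x. 0 \<le> N x \<and> N (\<lambda>\<gamma>. - x \<gamma>) = N x)"

lemma even_nonneg_lp_norm: "even_nonneg (lp_norm \<Gamma> p)"
  by (simp add: even_nonneg_def lp_norm_def)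

lemma Metric_space_norm:
  assumes N: "is_norm_on (lp \<Gamma> p) N" and e: "even_nonneg N" and p: "1 \<le> p"
  shows "Metric_space (lp \<Gamma> p) (\<lambda>x y. N (\<lambda>\<gamma>. x \<gamma> - y \<gamma>))"
proof
  fix x y z :: "'a \<Rightarrow> real"
  show "0 \<le> N (\<lambda>\<gamma>. x \<gamma> - y \<gamma>)" using e by (simp add: even_nonneg_def)
  show "N (\<lambda>\<gamma>. x \<gamma> - y \<gamma>) = N (\<lambda>\<gamma>. y \<gamma> - x \<gamma>)"
  proof -
    have "N (\<lambda>\<gamma>. - (x \<gamma> - y \<gamma>)) = N (\<lambda>\<gamma>. x \<gamma> - y \<gamma>)"
      using e unfolding even_nonneg_def by (elim allE conjE)
    then show ?thesis by simp
  qed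
  assume x: "x \<in> lp \<Gamma> p" and y: "y \<in> lp \<Gamma> p"
  have "N (\<lambda>\<gamma>. x \<gamma> - y \<gamma>) = 0 \<longleftrightarrow> (\<lambda>\<gamma>. x \<gamma> - y \<gamma>) = (\<lambda>\<gamma>. 0)"
    using N lp_diff[OF x y p] unfolding is_norm_on_def by simp
  then show "N (\<lambda>\<gamma>. x \<gamma> - y \<gamma>) = 0 \<longleftrightarrow> x = y" by (auto simp: fun_eq_iff)
  assume z: "z \<in> lp \<Gamma> p"
  have "\<forall>u\<in>lp \<Gamma> p. \<forall>v\<in>lp \<Gamma> p. N (\<lambda>\<gamma>. u \<gamma> + v \<gamma>) \<le> N u + N v"
    using N unfolding is_norm_on_def by (elim conjE)
  from this[rule_format, OF lp_diff[OF x y p] lp_diff[OF y z p]] show "N (\<lambda>\<gamma>. x \<gamma> - z \<gamma>) \<le> N (\<lambda>\<gamma>. x \<gamma> - y \<gamma>) + N (\<lambda>\<gamma>. y \<gamma> - z \<gamma>)" by simp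
qed

lemma openin_norm_topology:
  assumes "is_norm_on (lp \<Gamma> p) N" "even_nonneg N" "1 \<le> p"
  shows "openin (norm_topology (lp \<Gamma> p) N) W \<longleftrightarrow> W \<subseteq> lp \<Gamma> p \<and>
    (\<forall>x\<in>W. \<exists>r>0. \<forall>y\<in>lp \<Gamma> p. N (\<lambda>\<gamma>. x \<gamma> - y \<gamma>) < r \<longrightarrow> y \<in> W)"
proof -
  interpret Metric_space "lp \<Gamma> p" "\<lambda>x y. N (\<lambda>\<gamma>. x \<gamma> - y \<gamma>)"
    by (rule Metric_space_norm[OF assms])
  have ball: "mball x r \<subseteq> W \<longleftrightarrow> (\<forall>y\<in>lp \<Gamma> p. N (\<lambda>\<gamma>. x \<gamma> - y \<gamma>) < r \<longrightarrow> y \<in> W)"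
    if "x \<in> lp \<Gamma> p" for x r
    using that by (auto simp: subset_iff)
  have "(\<exists>r>0. mball x r \<subseteq> W) \<longleftrightarrow>
      (\<exists>r>0. \<forall>y\<in>lp \<Gamma> p. N (\<lambda>\<gamma>. x \<gamma> - y \<gamma>) < r \<longrightarrow> y \<in> W)"
    if "W \<subseteq> lp \<Gamma> p" "x \<in> W" for x
    using ball[OF subsetD[OF that]] by simp
  then show ?thesis
    unfolding norm_topology_def openin_mtopology Ball_def[of W]
    by (intro conj_cong all_cong1 imp_cong refl)
qed

lemma openin_norm_topology_mono:
  assumes N: "is_norm_on (lp \<Gamma> p) N" "even_nonneg N" and M: "is_norm_on (lp \<Gamma> p) M" "even_nonneg M"
    and p: "1 \<le> p" and d: "0 < d" "\<And>x. x \<in> lp \<Gamma> p \<Longrightarrow> M x \<le> d * N x"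
    and W: "openin (norm_topology (lp \<Gamma> p) M) W"
  shows "openin (norm_topology (lp \<Gamma> p) N) W"
  unfolding openin_norm_topology[OF N p]
proof (intro conjI ballI)
  show sub: "W \<subseteq> lp \<Gamma> p" using W unfolding openin_norm_topology[OF M p] by (elim conjE)
  fix x assume x: "x \<in> W"
  then obtain r where r: "r > 0" "\<forall>y\<in>lp \<Gamma> p. M (\<lambda>\<gamma>. x \<gamma> - y \<gamma>) < r \<longrightarrow> y \<in> W"
    using W unfolding openin_norm_topology[OF M p] by auto
  show "\<exists>r>0. \<forall>y\<in>lp \<Gamma> p. N (\<lambda>\<gamma>. x \<gamma> - y \<gamma>) < r \<longrightarrow> y \<in> W"
  proof (intro exI[of _ "r / d"] conjI ballI impI)
    show "0 < r / d" using r d by simp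
    fix y assume y: "y \<in> lp \<Gamma> p" "N (\<lambda>\<gamma>. x \<gamma> - y \<gamma>) < r / d"
    have "M (\<lambda>\<gamma>. x \<gamma> - y \<gamma>) \<le> d * N (\<lambda>\<gamma>. x \<gamma> - y \<gamma>)"
      using lp_diff[OF _ y(1) p, of x] sub x by (intro d(2)) auto
    also have "\<dots> < r" using y(2) d(1) by (simp add: field_simps)
    finally show "y \<in> W" using r(2) y(1) by simp
  qed
qed

text \<open>This makes the slices of the ball given by one coordinate weakly open.\<close>
lemma coordinate_in_lp_dual:
  assumes "\<gamma> \<in> \<Gamma>" and p: "1 \<le> p"
  shows "(\<lambda>x. x \<gamma>) \<in> lp_dual \<Gamma> p"
proof -
  note open_iff = openin_norm_topology[OF is_norm_on_lp_norm[OF p] even_nonneg_lp_norm p]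
  have top: "topspace (norm_topology (lp \<Gamma> p) (lp_norm \<Gamma> p)) = lp \<Gamma> p"
    unfolding norm_topology_def
    by (rule Metric_space.topspace_mtopology[OF
          Metric_space_norm[OF is_norm_on_lp_norm[OF p] even_nonneg_lp_norm p]])
  have "openin (norm_topology (lp \<Gamma> p) (lp_norm \<Gamma> p)) {x \<in> lp \<Gamma> p. x \<gamma> \<in> S}" if S: "open S" for S
    unfolding open_iff
  proof (intro conjI ballI)
    fix x assume x: "x \<in> {x \<in> lp \<Gamma> p. x \<gamma> \<in> S}"
    then obtain e where e: "e > 0" "\<And>s. \<bar>s - x \<gamma>\<bar> < e \<Longrightarrow> s \<in> S"
      using S x unfolding open_dist dist_real_def by auto
    have "y \<gamma> \<in> S" if y: "y \<in> lp \<Gamma> p" "lp_norm \<Gamma> p (\<lambda>\<gamma>. x \<gamma> - y \<gamma>) < e" for y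
    proof -
      have "\<bar>x \<gamma> - y \<gamma>\<bar> \<le> lp_norm \<Gamma> p (\<lambda>\<gamma>. x \<gamma> - y \<gamma>)"
        using abs_le_lp_norm[OF lp_diff[OF _ y(1) p, of x] p assms(1)] x by simp
      then show ?thesis using y(2) by (intro e(2)) linarith
    qed
    then show "\<exists>r>0. \<forall>y\<in>lp \<Gamma> p. lp_norm \<Gamma> p (\<lambda>\<gamma>. x \<gamma> - y \<gamma>) < r \<longrightarrow> y \<in> {x \<in> lp \<Gamma> p. x \<gamma> \<in> S}"
      using e(1) by auto
  qed auto
  then have "continuous_map (norm_topology (lp \<Gamma> p) (lp_norm \<Gamma> p)) euclideanreal (\<lambda>x. x \<gamma>)"
    by (simp add: continuous_map_def top)
  then show ?thesis by (simp add: lp_dual_def)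
qed

lemma topspace_weak_unit_ball: "topspace (weak_unit_ball \<Gamma> p N) = {x \<in> lp \<Gamma> p. N x \<le> 1}"
proof -
  have "(\<lambda>_. 0) \<in> lp_dual \<Gamma> p" by (simp add: lp_dual_def)
  then have "lp \<Gamma> p \<in> {{x \<in> lp \<Gamma> p. \<phi> x \<in> S} |\<phi> S. \<phi> \<in> lp_dual \<Gamma> p \<and> open S}"
    by (intro CollectI exI[of _ "\<lambda>_. 0"] exI[of _ UNIV]) auto
  then have "topspace (lp_weak_topology \<Gamma> p) = lp \<Gamma> p"
    unfolding lp_weak_topology_def topology_generated_by_topspace by auto
  then show ?thesis by (auto simp: weak_unit_ball_def)
qed

lemma openin_weak_unit_ball_coordinate:
  assumes "\<gamma> \<in> \<Gamma>" "1 \<le> p" "open S"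
  shows "openin (weak_unit_ball \<Gamma> p N) {x \<in> lp \<Gamma> p. N x \<le> 1 \<and> x \<gamma> \<in> S}"
proof -
  have "openin (lp_weak_topology \<Gamma> p) {x \<in> lp \<Gamma> p. x \<gamma> \<in> S}"
    unfolding lp_weak_topology_def
    using coordinate_in_lp_dual[OF assms(1,2)] assms(3)
    by (intro topology_generated_by_Basis CollectI exI[of _ "\<lambda>x. x \<gamma>"] exI[of _ S]) auto
  then have "openin (weak_unit_ball \<Gamma> p N) ({x \<in> lp \<Gamma> p. N x \<le> 1} \<inter> {x \<in> lp \<Gamma> p. x \<gamma> \<in> S})"
    unfolding weak_unit_ball_def by (rule openin_subtopology_Int2)
  also have "{x \<in> lp \<Gamma> p. N x \<le> 1} \<inter> {x \<in> lp \<Gamma> p. x \<gamma> \<in> S} = {x \<in> lp \<Gamma> p. N x \<le> 1 \<and> x \<gamma> \<in> S}"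
    by auto
  finally show ?thesis .
qed

section \<open>The norm of a graph\<close>

text \<open>
  The 0 keeps the supremum meaningful when there are no edges, and the maximum with the original
  norm makes the value nonnegative on all functions, including those for which the supremum does
  not exist.
\<close>
definition graph_norm :: "('g \<Rightarrow> 'g \<Rightarrow> bool) \<Rightarrow> 'g set \<Rightarrow> real \<Rightarrow> ('g \<Rightarrow> real) \<Rightarrow> real" where
  "graph_norm G \<Gamma> p x =
     max (lp_norm \<Gamma> p x) (Sup (insert 0 {\<bar>x a\<bar> + \<bar>x b\<bar> | a b. a \<in> \<Gamma> \<and> b \<in> \<Gamma> \<and> G a b}))"

text \<open>
  The coordinates are bounded by the norm of $\ell_p$, so the supremum exists. All further
  properties of the norm follow from this description of its balls.
\<close>
lemma graph_norm_le_iff: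
  assumes x: "x \<in> lp \<Gamma> p" and p: "1 \<le> p"
  shows "graph_norm G \<Gamma> p x \<le> c \<longleftrightarrow>
    lp_norm \<Gamma> p x \<le> c \<and> (\<forall>a\<in>\<Gamma>. \<forall>b\<in>\<Gamma>. G a b \<longrightarrow> \<bar>x a\<bar> + \<bar>x b\<bar> \<le> c)"
proof -
  let ?S = "insert 0 {\<bar>x a\<bar> + \<bar>x b\<bar> | a b. a \<in> \<Gamma> \<and> b \<in> \<Gamma> \<and> G a b}"
  have "\<bar>x a\<bar> + \<bar>x b\<bar> \<le> 2 * lp_norm \<Gamma> p x" if "a \<in> \<Gamma>" "b \<in> \<Gamma>" for a b
    using abs_le_lp_norm[OF x p that(1)] abs_le_lp_norm[OF x p that(2)] by linarith
  then have "s \<le> 2 * lp_norm \<Gamma> p x" if "s \<in> ?S" for s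
    using that lp_norm_nonneg[of \<Gamma> p x] by auto
  then have "bdd_above ?S" by (rule bdd_aboveI)
  then have "Sup ?S \<le> c \<longleftrightarrow> (\<forall>s\<in>?S. s \<le> c)" by (intro cSup_le_iff) auto
  also have "\<dots> \<longleftrightarrow> 0 \<le> c \<and> (\<forall>a\<in>\<Gamma>. \<forall>b\<in>\<Gamma>. G a b \<longrightarrow> \<bar>x a\<bar> + \<bar>x b\<bar> \<le> c)" by auto
  finally show ?thesis using lp_norm_nonneg[of \<Gamma> p x] by (auto simp: graph_norm_def)
qed

lemma edge_le_graph_norm:
  assumes "x \<in> lp \<Gamma> p" "1 \<le> p" "a \<in> \<Gamma>" "b \<in> \<Gamma>" "G a b"
  shows "\<bar>x a\<bar> + \<bar>x b\<bar> \<le> graph_norm G \<Gamma> p x"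
  using graph_norm_le_iff[OF assms(1,2), of G "graph_norm G \<Gamma> p x"] assms(3-5) by simp

lemma lp_norm_le_graph_norm: "lp_norm \<Gamma> p x \<le> graph_norm G \<Gamma> p x"
  by (simp add: graph_norm_def)

lemma graph_norm_le_lp_norm:
  assumes "x \<in> lp \<Gamma> p" "1 \<le> p"
  shows "graph_norm G \<Gamma> p x \<le> 2 * lp_norm \<Gamma> p x"
  unfolding graph_norm_le_iff[OF assms]
proof (intro conjI ballI impI)
  show "lp_norm \<Gamma> p x \<le> 2 * lp_norm \<Gamma> p x" using lp_norm_nonneg[of \<Gamma> p x] by simp
  fix a b assume "a \<in> \<Gamma>" "b \<in> \<Gamma>"
  then show "\<bar>x a\<bar> + \<bar>x b\<bar> \<le> 2 * lp_norm \<Gamma> p x"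
    using abs_le_lp_norm[OF assms, of a] abs_le_lp_norm[OF assms, of b] by linarith
qed

lemma graph_norm_nonneg: "0 \<le> graph_norm G \<Gamma> p x"
  using lp_norm_nonneg lp_norm_le_graph_norm by (rule order_trans)

lemma even_nonneg_graph_norm: "even_nonneg (graph_norm G \<Gamma> p)"
proof -
  have "graph_norm G \<Gamma> p (\<lambda>\<gamma>. - x \<gamma>) = graph_norm G \<Gamma> p x" for x
    by (simp add: graph_norm_def lp_norm_def)
  then show ?thesis by (simp add: even_nonneg_def graph_norm_nonneg)
qed

lemma graph_norm_scale_le:
  assumes x: "x \<in> lp \<Gamma> p" and p: "1 \<le> p"
  shows "graph_norm G \<Gamma> p (\<lambda>\<gamma>. c * x \<gamma>) \<le> \<bar>c\<bar> * graph_norm G \<Gamma> p x"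
  unfolding graph_norm_le_iff[OF lp_scale[OF x] p] lp_norm_scale[OF p]
proof (intro conjI ballI impI)
  show "\<bar>c\<bar> * lp_norm \<Gamma> p x \<le> \<bar>c\<bar> * graph_norm G \<Gamma> p x"
    by (intro mult_left_mono lp_norm_le_graph_norm) simp
  fix a b assume "a \<in> \<Gamma>" "b \<in> \<Gamma>" "G a b"
  then have "\<bar>c\<bar> * (\<bar>x a\<bar> + \<bar>x b\<bar>) \<le> \<bar>c\<bar> * graph_norm G \<Gamma> p x"
    by (intro mult_left_mono edge_le_graph_norm[OF x p]) simp_all
  then show "\<bar>c * x a\<bar> + \<bar>c * x b\<bar> \<le> \<bar>c\<bar> * graph_norm G \<Gamma> p x"
    by (simp add: abs_mult distrib_left)
qed

lemma is_norm_on_graph_norm: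
  assumes p: "1 \<le> p"
  shows "is_norm_on (lp \<Gamma> p) (graph_norm G \<Gamma> p)"
  unfolding is_norm_on_def
proof (intro conjI ballI allI)
  fix x assume x: "x \<in> lp \<Gamma> p"
  show "0 \<le> graph_norm G \<Gamma> p x"
    by (rule graph_norm_nonneg)
  then show "graph_norm G \<Gamma> p x = 0 \<longleftrightarrow> x = (\<lambda>\<gamma>. 0)"
    using lp_norm_eq_0_iff[OF x p] lp_norm_nonneg[of \<Gamma> p x] lp_norm_le_graph_norm[of \<Gamma> p x G]
      graph_norm_le_lp_norm[OF x p, of G] by auto
  show "graph_norm G \<Gamma> p (\<lambda>\<gamma>. c * x \<gamma>) = \<bar>c\<bar> * graph_norm G \<Gamma> p x" for c
  proof (rule antisym[OF graph_norm_scale_le[OF x p]])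
    show "\<bar>c\<bar> * graph_norm G \<Gamma> p x \<le> graph_norm G \<Gamma> p (\<lambda>\<gamma>. c * x \<gamma>)"
    proof (cases "c = 0")
      case True
      then show ?thesis by (simp add: graph_norm_nonneg)
    next
      case False
      have "graph_norm G \<Gamma> p (\<lambda>\<gamma>. (1 / c) * (c * x \<gamma>)) \<le> \<bar>1 / c\<bar> * graph_norm G \<Gamma> p (\<lambda>\<gamma>. c * x \<gamma>)"
        by (rule graph_norm_scale_le[OF lp_scale[OF x] p])
      then show ?thesis using False by (simp add: field_simps)
    qed
  qed
next
  fix x y assume x: "x \<in> lp \<Gamma> p" and y: "y \<in> lp \<Gamma> p"
  let ?N = "graph_norm G \<Gamma> p"
  have "lp_norm \<Gamma> p (\<lambda>\<gamma>. x \<gamma> + y \<gamma>) \<le> ?N x + ?N y"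
    using lp_norm_triangle[OF x y p] lp_norm_le_graph_norm[of \<Gamma> p x G]
      lp_norm_le_graph_norm[of \<Gamma> p y G] by linarith
  moreover have "\<bar>x a + y a\<bar> + \<bar>x b + y b\<bar> \<le> ?N x + ?N y" if "a \<in> \<Gamma>" "b \<in> \<Gamma>" "G a b" for a b
    using edge_le_graph_norm[where G = G, OF x p that]
      edge_le_graph_norm[where G = G, OF y p that] by linarith
  ultimately show "?N (\<lambda>\<gamma>. x \<gamma> + y \<gamma>) \<le> ?N x + ?N y"
    by (simp add: graph_norm_le_iff[OF lp_add[OF x y p] p])
qed

lemma equivalent_lp_norm_graph_norm:
  assumes p: "1 \<le> p"
  shows "equivalent_lp_norm \<Gamma> p (graph_norm G \<Gamma> p)"
proof -
  note N = is_norm_on_graph_norm[OF p, of \<Gamma> G] even_nonneg_graph_norm[of G \<Gamma> p]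
  note M = is_norm_on_lp_norm[OF p, of \<Gamma>] even_nonneg_lp_norm[of \<Gamma> p]
  have "openin (norm_topology (lp \<Gamma> p) (graph_norm G \<Gamma> p)) W"
    if "openin (norm_topology (lp \<Gamma> p) (lp_norm \<Gamma> p)) W" for W
    by (rule openin_norm_topology_mono[OF N M p, of 1]) (simp_all add: lp_norm_le_graph_norm that)
  moreover have "openin (norm_topology (lp \<Gamma> p) (lp_norm \<Gamma> p)) W"
    if "openin (norm_topology (lp \<Gamma> p) (graph_norm G \<Gamma> p)) W" for W
    by (rule openin_norm_topology_mono[OF M N p, of 2]) (simp_all add: graph_norm_le_lp_norm p that)
  ultimately show ?thesis using N(1) by (auto simp: equivalent_lp_norm_def topology_eq)
qed

text \<open>
  This vector has norm 1 in $\ell_p$. Since \<open>{a, b}\<close> is not an edge and there are no loops,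
  every edge sees at most one of its two nonzero coordinates, which is at most 1.
\<close>
lemma graph_norm_two_coordinates:
  assumes ab: "a \<in> \<Gamma>" "b \<in> \<Gamma>" "a \<noteq> b" "\<not> G a b" and G: "symp G" "irreflp G" and p: "1 < p"
    and t: "t = 2 powr (- 1 / p)"
  defines "x \<equiv> \<lambda>\<gamma>. if \<gamma> = a \<or> \<gamma> = b then t else 0"
  shows "x \<in> lp \<Gamma> p" and "graph_norm G \<Gamma> p x \<le> 1"
proof -
  have t0: "0 < t" by (simp add: t)
  have t1: "t \<le> 1" using p powr_mono[of "- 1 / p" 0 2] by (simp add: t)
  have "t powr p = 2 powr (- 1 / p * p)" unfolding t by (rule powr_powr)
  then have tp: "t powr p = 1 / 2" using p by (simp add: powr_minus_divide)
  have "((\<lambda>\<gamma>. \<bar>x \<gamma>\<bar> powr p) has_sum (\<Sum>\<gamma>\<in>{a, b}. \<bar>x \<gamma>\<bar> powr p)) {a, b}"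
    by (rule has_sum_finite) simp
  moreover have "(\<Sum>\<gamma>\<in>{a, b}. \<bar>x \<gamma>\<bar> powr p) = 1" using ab(3) t0 tp by (simp add: x_def)
  ultimately have "((\<lambda>\<gamma>. \<bar>x \<gamma>\<bar> powr p) has_sum 1) {a, b}" by simp
  then have s: "((\<lambda>\<gamma>. \<bar>x \<gamma>\<bar> powr p) has_sum 1) \<Gamma>"
    by (rule has_sum_cong_neutral[THEN iffD1, rotated -1]) (use ab in \<open>auto simp: x_def\<close>)
  show x: "x \<in> lp \<Gamma> p" using has_sum_imp_summable[OF s] ab by (auto simp: lp_iff x_def)
  have "lp_norm \<Gamma> p x = 1" using infsumI[OF s] by (simp add: lp_norm_def)
  moreover have "\<bar>x c\<bar> + \<bar>x d\<bar> \<le> 1" if "G c d" for c d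
  proof -
    have "c \<noteq> d" using that G(2) by (auto simp: irreflp_def)
    moreover have "\<not> G b a" using ab(4) G(1) by (auto dest: sympD)
    ultimately have "x c = 0 \<or> x d = 0" using that ab(4) by (auto simp: x_def)
    then show ?thesis using t0 t1 by (auto simp: x_def)
  qed
  ultimately show "graph_norm G \<Gamma> p x \<le> 1" using p by (simp add: graph_norm_le_iff[OF x])
qed

section \<open>The weak unit ball of the norm of a graph\<close>

lemma openin_weak_unit_ball_above:
  assumes "\<gamma> \<in> \<Gamma>" "1 \<le> p"
  shows "openin (weak_unit_ball \<Gamma> p N) {x \<in> lp \<Gamma> p. N x \<le> 1 \<and> s < x \<gamma>}"
  using openin_weak_unit_ball_coordinate[OF assms, of "{s<..}" N] by simp

text \<open>The set where the coordinate is at least \<open>s\<close> is weakly closed and lies in between.\<close>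
lemma closure_of_above_subset:
  assumes "\<gamma> \<in> \<Gamma>" "1 \<le> p" "r < s"
  shows "weak_unit_ball \<Gamma> p N closure_of {x \<in> lp \<Gamma> p. N x \<le> 1 \<and> s < x \<gamma>}
    \<subseteq> {x \<in> lp \<Gamma> p. N x \<le> 1 \<and> r < x \<gamma>}"
proof -
  let ?K = "weak_unit_ball \<Gamma> p N"
  let ?F = "topspace ?K - {x \<in> lp \<Gamma> p. N x \<le> 1 \<and> x \<gamma> \<in> {..<s}}"
  have "closedin ?K ?F"
    by (intro closedin_diff closedin_topspace openin_weak_unit_ball_coordinate assms open_lessThan)
  moreover have "{x \<in> lp \<Gamma> p. N x \<le> 1 \<and> s < x \<gamma>} \<subseteq> ?F"
    by (auto simp: topspace_weak_unit_ball)
  ultimately have "?K closure_of {x \<in> lp \<Gamma> p. N x \<le> 1 \<and> s < x \<gamma>} \<subseteq> ?F"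
    by (rule closure_of_minimal[rotated])
  also have "?F \<subseteq> {x \<in> lp \<Gamma> p. N x \<le> 1 \<and> r < x \<gamma>}"
    using assms(3) by (auto simp: topspace_weak_unit_ball)
  finally show ?thesis .
qed

text \<open>
  Such families translate cliques of \<open>G\<close> into disjointness of the smaller sets, and
  independence into intersection of the larger ones.
\<close>
lemma graph_norm_ball_family:
  fixes \<Gamma> :: "'g set" and G :: "'g \<Rightarrow> 'g \<Rightarrow> bool"
  assumes G: "symp G" "irreflp G" and p: "1 < p"
  obtains U V :: "'g \<Rightarrow> ('g \<Rightarrow> real) set" where
    "\<forall>a\<in>\<Gamma>. openin (weak_unit_ball \<Gamma> p (graph_norm G \<Gamma> p)) (U a) \<and>
      openin (weak_unit_ball \<Gamma> p (graph_norm G \<Gamma> p)) (V a) \<and>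
      weak_unit_ball \<Gamma> p (graph_norm G \<Gamma> p) closure_of U a \<subseteq> V a"
    "\<forall>a\<in>\<Gamma>. \<forall>b\<in>\<Gamma>. a \<noteq> b \<longrightarrow> U a \<inter> U b = {} \<longrightarrow> G a b"
    "\<forall>a\<in>\<Gamma>. \<forall>b\<in>\<Gamma>. a \<noteq> b \<longrightarrow> V a \<inter> V b \<noteq> {} \<longrightarrow> \<not> G a b"
proof -
  let ?N = "graph_norm G \<Gamma> p"
  have p1: "1 \<le> p" using p by simp
  define t :: real where "t = 2 powr (- 1 / p)"
  have "(2::real) powr - 1 < t" unfolding t_def using p by (intro powr_less_mono) (auto simp: field_simps)
  then have t: "1 / 2 < t" by (simp add: powr_minus_divide)
  \<comment> \<open>\<open>V\<close> needs the threshold 1/2, so that two coordinates above it violate an edge; \<open>U\<close> needs one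
    below \<open>t\<close>, so that it contains the vector with two coordinates \<open>t\<close>.\<close>
  then obtain s where s: "1 / 2 < s" "s < t" using dense by blast
  define B where "B r a = {x \<in> lp \<Gamma> p. ?N x \<le> 1 \<and> r < x a}" for r a
  have "\<forall>a\<in>\<Gamma>. openin (weak_unit_ball \<Gamma> p ?N) (B s a) \<and>
      openin (weak_unit_ball \<Gamma> p ?N) (B (1 / 2) a) \<and>
      weak_unit_ball \<Gamma> p ?N closure_of B s a \<subseteq> B (1 / 2) a"
    unfolding B_def using p1 s(1)
    by (intro ballI conjI openin_weak_unit_ball_above closure_of_above_subset)
  moreover have "\<forall>a\<in>\<Gamma>. \<forall>b\<in>\<Gamma>. a \<noteq> b \<longrightarrow> B s a \<inter> B s b = {} \<longrightarrow> G a b"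
  proof (intro ballI impI, rule ccontr)
    fix a b assume ab: "a \<in> \<Gamma>" "b \<in> \<Gamma>" "a \<noteq> b" "B s a \<inter> B s b = {}" "\<not> G a b"
    let ?x = "\<lambda>\<gamma>. if \<gamma> = a \<or> \<gamma> = b then t else 0"
    have "?x \<in> B s a \<inter> B s b"
      using graph_norm_two_coordinates[OF ab(1,2,3,5) G p t_def] s(2) by (simp add: B_def)
    then show False using ab(4) by simp
  qed
  moreover have "\<forall>a\<in>\<Gamma>. \<forall>b\<in>\<Gamma>. a \<noteq> b \<longrightarrow> B (1 / 2) a \<inter> B (1 / 2) b \<noteq> {} \<longrightarrow> \<not> G a b"
  proof (intro ballI impI notI)
    fix a b assume ab: "a \<in> \<Gamma>" "b \<in> \<Gamma>" "B (1 / 2) a \<inter> B (1 / 2) b \<noteq> {}" "G a b"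
    then obtain x where x: "x \<in> lp \<Gamma> p" "?N x \<le> 1" "1 / 2 < x a" "1 / 2 < x b"
      by (auto simp: B_def)
    then show False using edge_le_graph_norm[where G = G, OF x(1) p1 ab(1,2,4)] by linarith
  qed
  ultimately show thesis by (rule that)
qed

theorem theorem4:
  fixes \<Gamma> :: "'g set" and p :: real
  assumes "uncountable \<Gamma>" and "1 < p"
  shows "\<exists>N. equivalent_lp_norm \<Gamma> p N \<and>
           \<not> property_Q (weak_unit_ball \<Gamma> p N) \<and>
           \<not> polyadic (weak_unit_ball \<Gamma> p N)"
proof -
  obtain I G where I: "I \<subseteq> \<Gamma>" "|I| =o cardSuc natLeq" and G: "symp G" "irreflp G"
    and clique: "\<forall>A\<subseteq>I. pairwise G A \<longrightarrow> countable A"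
    and indep: "\<forall>A\<subseteq>I. pairwise (\<lambda>a b. \<not> G a b) A \<longrightarrow> countable A"
    by (rule Sierpinski_graph[OF assms(1)])
  let ?N = "graph_norm G \<Gamma> p"
  let ?K = "weak_unit_ball \<Gamma> p ?N"
  obtain U V where UV: "\<forall>a\<in>\<Gamma>. openin ?K (U a) \<and> openin ?K (V a) \<and> ?K closure_of U a \<subseteq> V a"
    and U: "\<forall>a\<in>\<Gamma>. \<forall>b\<in>\<Gamma>. a \<noteq> b \<longrightarrow> U a \<inter> U b = {} \<longrightarrow> G a b"
    and V: "\<forall>a\<in>\<Gamma>. \<forall>b\<in>\<Gamma>. a \<noteq> b \<longrightarrow> V a \<inter> V b \<noteq> {} \<longrightarrow> \<not> G a b"
    by (rule graph_norm_ball_family[OF G assms(2)])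
  have no_U: "countable A" if "A \<subseteq> I" "pairwise (\<lambda>a b. U a \<inter> U b = {}) A" for A
  proof -
    have "pairwise G A" using that I(1) U by (auto simp: pairwise_def subset_iff)
    then show ?thesis using clique that(1) by simp
  qed
  have no_V: "countable A" if "A \<subseteq> I" "pairwise (\<lambda>a b. V a \<inter> V b \<noteq> {}) A" for A
  proof -
    have "pairwise (\<lambda>a b. \<not> G a b) A" using that I(1) V by (simp add: pairwise_def subset_iff)
    then show ?thesis using indep that(1) by simp
  qed
  have "\<not> property_Q ?K"
  proof
    assume "property_Q ?K"
    then have "property_Q_at |I| ?K"
      by (rule property_Q_imp_property_Q_at[OF _ uncountable_regular_cardinal_aleph1[OF I(2)]])
    moreover have "\<forall>a\<in>Field |I|. openin ?K (U a) \<and> openin ?K (V a) \<and> ?K closure_of U a \<subseteq> V a"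
      using UV I(1) by (simp add: Field_card_of subset_iff)
    ultimately have "(\<exists>A\<subseteq>I. |A| =o |I| \<and> (\<forall>a\<in>A. \<forall>b\<in>A. a \<noteq> b \<longrightarrow> U a \<inter> U b = {})) \<or>
        (\<exists>A\<subseteq>I. |A| =o |I| \<and> (\<forall>a\<in>A. \<forall>b\<in>A. a \<noteq> b \<longrightarrow> V a \<inter> V b \<noteq> {}))"
      unfolding property_Q_at_def by (simp add: Field_card_of)
    then obtain A where "A \<subseteq> I" "|A| =o |I|" and
      "pairwise (\<lambda>a b. U a \<inter> U b = {}) A \<or> pairwise (\<lambda>a b. V a \<inter> V b \<noteq> {}) A"
      unfolding pairwise_def by (elim disjE exE conjE) simp_all
    moreover from this(2) have "uncountable A"
      by (rule uncountable_if_aleph1[OF ordIso_transitive[OF _ I(2)]])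
    ultimately show False using no_U no_V by auto
  qed
  moreover have "\<not> polyadic ?K"
  proof
    assume poly: "polyadic ?K"
    show False
    proof (rule polyadic_uncountable_dichotomy[OF poly uncountable_if_aleph1[OF I(2)], of U V])
      fix A assume "A \<subseteq> I" "uncountable A" "pairwise (\<lambda>a b. U a \<inter> U b = {}) A"
      then show False using no_U by simp
    next
      fix A assume "A \<subseteq> I" "uncountable A" "pairwise (\<lambda>a b. V a \<inter> V b \<noteq> {}) A"
      then show False using no_V by simp
    qed (use UV I(1) in auto)
  qed
  moreover have "equivalent_lp_norm \<Gamma> p ?N"
    by (rule equivalent_lp_norm_graph_norm) (use assms(2) in simp)
  ultimately show ?thesis by blast
qed

end
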